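(* Let $\beta>1$ be a non-integer and $p\in(0,1)$. The skew product transformation $R_\beta$ is ergodic with respect to the measure $m_p\otimes\mu_{\mathbf 1^*}$. Furthermore, the measures $m_p\otimes\mu_{\mathbf 1^*}$ and $m_p\otimes\lambda$ are equivalent (mutually absolutely continuous), and the density $\mathbf 1^*$ is bounded below by a positive constant $d$, everywhere on $J_\beta$.
   Context: Let $J_\beta=[0,\lfloor\beta\rfloor/(\beta-1)]$ with Borel $\sigma$-algebra $\mathcal B$, and let $\lambda$ be the normalized Lebesgue measure on $J_\beta$. The greedy map $T_\beta:J_\beta\to J_\beta$ is $T_\beta(x)=\beta x-d$ for $x\in C(d)$, where $C(j)=[j/\beta,(j+1)/\beta)$ for $0\le j\le\lfloor\beta\rfloor-1$ and $C(\lfloor\beta\rfloor)=[\lfloor\beta\rfloor/\beta,\lfloor\beta\rfloor/(\beta-1)]$. With $\ell(x)=\lfloor\beta\rfloor/(\beta-1)-x$, the lazy map $L_\beta:J_\beta\to J_\beta$ is $L_\beta(x)=\beta x-d$ for $x\in\Delta(d)=\ell(C(\lfloor\beta\rfloor-d))$, $d\in\{0,\ldots,\lfloor\beta\rfloor\}$. Let $\Omega=\{0,1\}^{\mathbb N}$ with product $\sigma$-algebra $\mathcal A$ and left shift $\sigma$; $m_p$ is the Bernoulli measure on $\Omega$: $m_p(\{\omega_1=i_1,\ldots,\omega_n=i_n\})=p^{\sum_j i_j}(1-p)^{n-\sum_j i_j}$. The skew product $R_\beta$ on $(\Omega\times J_\beta,\mathcal A\otimes\mathcal B)$ is $R_\beta(\omega,x)=(\sigma(\omega),T_\beta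 x)$ if $\omega_1=1$ and $R_\beta(\omega,x)=(\sigma(\omega),L_\beta x)$ if $\omega_1=0$. For a nonsingular $T:J_\beta\to J_\beta$, the Frobenius-Perron operator $P_T$ on probability densities $f$ with respect to $\lambda$ is defined by $\int_B P_Tf\,d\lambda=\int_{T^{-1}B}f\,d\lambda$ for all $B\in\mathcal B$. Put $Pf=p\cdot P_{T_\beta}f+(1-p)\cdot P_{L_\beta}f$. By a theorem of Pelikan, the limit $\mathbf 1^*=\lim_{n\to\infty}\frac1n\sum_{j=0}^{n-1}P^j\mathbf 1$ exists in $L_1(J_\beta,\lambda)$ (here $\mathbf 1$ is the constant function $1$), satisfies $P\mathbf 1^*=\mathbf 1^*$, and can be chosen to be of bounded variation. Take such a version of bounded variation and modify it as follows: at each discontinuity point $x$ in the interior of $J_\beta$ set $\mathbf 1^*(x)=\min\{\mathbf 1^*(x^-),\mathbf 1^*(x^+)\}$, and at each endpoint of $J_\beta$ set $\mathbf 1^*$ equal to its one-sided limit there. This (lower semicontinuous) version is the one denoted $\mathbf 1^*$. The measure $\mu_{\mathbf 1^*}$ is $\mu_{\mathbf 1^*}(B)=\int_B\mathbf 1^*\,d\lambda$, $B\in\mathcal B$. *)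

theory Defs
  imports "HOL-Probability.Probability"
begin

definition J :: "real \<Rightarrow> real set" where
  "J \<beta> = {0 .. of_int \<lfloor>\<beta>\<rfloor> / (\<beta> - 1)}"

definition lambda :: "real \<Rightarrow> real measure" where
  "lambda \<beta> = uniform_measure (restrict_space lborel (J \<beta>)) (J \<beta>)"

definition greedy_cell :: "real \<Rightarrow> int \<Rightarrow> real set" where
  "greedy_cell \<beta> d =
     (if d = \<lfloor>\<beta>\<rfloor> then {of_int \<lfloor>\<beta>\<rfloor> / \<beta> .. of_int \<lfloor>\<beta>\<rfloor> / (\<beta> - 1)}
      else {of_int d / \<beta> ..< (of_int d + 1) / \<beta>})"

definition reflect :: "real \<Rightarrow> real \<Rightarrow> real" where
  "reflect \<beta> x = of_int \<lfloor>\<beta>\<rfloor> / (\<beta> - 1) - x"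

definition lazy_cell :: "real \<Rightarrow> int \<Rightarrow> real set" where
  "lazy_cell \<beta> d = reflect \<beta> ` greedy_cell \<beta> (\<lfloor>\<beta>\<rfloor> - d)"

text \<open>For \<open>\<beta> > 1\<close> the greedy cells with digits \<open>0, \<dots>, \<lfloor>\<beta>\<rfloor>\<close> partition \<open>J \<beta>\<close>, and so do the
  lazy cells. Hence the digit below is uniquely determined for \<open>x \<in> J \<beta>\<close>;
  the values of both maps outside \<open>J \<beta>\<close> are irrelevant.\<close>

definition greedy_map :: "real \<Rightarrow> real \<Rightarrow> real" where
  "greedy_map \<beta> x = \<beta> * x - of_int (THE d. d \<in> {0..\<lfloor>\<beta>\<rfloor>} \<and> x \<in> greedy_cell \<beta> d)"

definition lazy_map :: "real \<Rightarrow> real \<Rightarrow> real" where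
  "lazy_map \<beta> x = \<beta> * x - of_int (THE d. d \<in> {0..\<lfloor>\<beta>\<rfloor>} \<and> x \<in> lazy_cell \<beta> d)"

text \<open>The symbols 1 and 0 are encoded as \<^term>\<open>True\<close> and \<^term>\<open>False\<close>, and the first
  coordinate of a sequence \<open>\<omega>\<close> is \<open>\<omega> 0\<close>.\<close>

definition bernoulli_measure :: "real \<Rightarrow> (nat \<Rightarrow> bool) measure" where
  "bernoulli_measure p = PiM UNIV (\<lambda>_. measure_pmf (bernoulli_pmf p))"

definition shift :: "(nat \<Rightarrow> 'a) \<Rightarrow> nat \<Rightarrow> 'a" where
  "shift \<omega> = (\<lambda>n. \<omega> (Suc n))"

definition skew_product :: "real \<Rightarrow> (nat \<Rightarrow> bool) \<times> real \<Rightarrow> (nat \<Rightarrow> bool) \<times> real" where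
  "skew_product \<beta> = (\<lambda>(\<omega>, x). (shift \<omega>, if \<omega> 0 then greedy_map \<beta> x else lazy_map \<beta> x))"

text \<open>The defining equation determines the density only up to a null set; an arbitrary version
  is chosen.\<close>

definition frobenius_perron :: "'a measure \<Rightarrow> ('a \<Rightarrow> 'a) \<Rightarrow> ('a \<Rightarrow> real) \<Rightarrow> 'a \<Rightarrow> real" where
  "frobenius_perron M T f =
     (SOME g. integrable M g \<and>
        (\<forall>B\<in>sets M. (LINT x:B|M. g x) = (LINT x:(T -` B \<inter> space M)|M. f x)))"

definition random_operator :: "real \<Rightarrow> real \<Rightarrow> (real \<Rightarrow> real) \<Rightarrow> real \<Rightarrow> real" where
  "random_operator \<beta> p f = (\<lambda>x.
     p * frobenius_perron (lambda \<beta>) (greedy_map \<beta>) f x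
     + (1 - p) * frobenius_perron (lambda \<beta>) (lazy_map \<beta>) f x)"

definition cesaro :: "real \<Rightarrow> real \<Rightarrow> nat \<Rightarrow> real \<Rightarrow> real" where
  "cesaro \<beta> p n x = (1 / real n) * (\<Sum>j<n. (random_operator \<beta> p ^^ j) (\<lambda>_. 1) x)"

definition L1_limit :: "'a measure \<Rightarrow> (nat \<Rightarrow> 'a \<Rightarrow> real) \<Rightarrow> ('a \<Rightarrow> real) \<Rightarrow> bool" where
  "L1_limit M F g \<longleftrightarrow>
     integrable M g \<and> (\<lambda>n. \<integral>\<^sup>+ x. ennreal \<bar>F n x - g x\<bar> \<partial>M) \<longlonglongrightarrow> 0"

definition bounded_variation_on :: "real set \<Rightarrow> (real \<Rightarrow> real) \<Rightarrow> bool" where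
  "bounded_variation_on S f \<longleftrightarrow>
     (\<exists>V. \<forall>n x. strict_mono_on {..n} x \<and> x ` {..n} \<subseteq> S \<longrightarrow>
        (\<Sum>i<n. \<bar>f (x (Suc i)) - f (x i)\<bar>) \<le> V)"

definition bv_limit_density :: "real \<Rightarrow> real \<Rightarrow> (real \<Rightarrow> real) \<Rightarrow> bool" where
  "bv_limit_density \<beta> p g \<longleftrightarrow>
     bounded_variation_on (J \<beta>) g \<and> L1_limit (lambda \<beta>) (cesaro \<beta> p) g"

definition lsc_version :: "real \<Rightarrow> real \<Rightarrow> (real \<Rightarrow> real) \<Rightarrow> real \<Rightarrow> real" where
  "lsc_version a b g x =
     (if x = a then Lim (at_right a) g
      else if x = b then Lim (at_left b) g
      else if x \<in> {a<..<b} \<and> \<not> isCont g x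
        then min (Lim (at_left x) g) (Lim (at_right x) g)
      else g x)"

definition one_star :: "real \<Rightarrow> (real \<Rightarrow> real) \<Rightarrow> real \<Rightarrow> real" where
  "one_star \<beta> g = lsc_version 0 (of_int \<lfloor>\<beta>\<rfloor> / (\<beta> - 1)) g"

definition mu_density :: "real \<Rightarrow> (real \<Rightarrow> real) \<Rightarrow> real measure" where
  "mu_density \<beta> f = density (lambda \<beta>) (\<lambda>x. ennreal (f x))"

text \<open>As usual, ergodicity includes invariance of the measure.\<close>

definition ergodic :: "'a measure \<Rightarrow> ('a \<Rightarrow> 'a) \<Rightarrow> bool" where
  "ergodic M R \<longleftrightarrow>
     R \<in> measurable M M \<and> distr M M R = M \<and>
     (\<forall>A\<in>sets M. R -` A \<inter> space M = A \<longrightarrow>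
        emeasure M A = 0 \<or> emeasure M (space M - A) = 0)"

end

theory Submission
  imports Defs
begin

text \<open>A random orbit step expands lengths by \<open>\<beta>\<close>, and any interval can be driven onto all of \<open>J\<close>: greedy
  branches stretch it until it covers a greedy discontinuity, the next greedy step produces a neighbourhood
  of \<open>0\<close>, and the lazy digit-\<open>0\<close> branch blows that up to \<open>J\<close>. The density is bounded below near some point of
  continuity, and stationarity transports this lower bound along the branches to the whole of \<open>J\<close>.

  For ergodicity, let \<open>f x\<close> be the measure of the section at \<open>x\<close> of an invariant set \<open>A\<close>. It satisfies
  \<open>f = p f \<circ> T + (1 - p) f \<circ> L\<close>, and since the squares integrate to the same value, strict convexity gives
  \<open>f \<circ> T = f \<circ> L = f\<close> almost everywhere. A superlevel set of \<open>f\<close> that is not null almost fills some short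
  interval; expanding it to a definite length without losing relative density and passing to a limit yields an
  interval filled completely, hence all of \<open>J\<close>. So \<open>f\<close> is a constant \<open>c\<close>, the sections of \<open>A\<close> are independent of
  all cylinders, and \<open>A\<close> is independent of itself.\<close>

text \<open>Both uses of expansion concern a property \<open>P a b\<close> of intervals that every
  straight branch of either map carries from an interval to its image. Which map is applied is a
  free choice: for the lower bound because each branch has positive weight in the stationarity
  equation, for the level set because it is invariant under each map separately. The obstacle is the
  cut at a discontinuity. A lower bound or a complete filling passes to every subinterval, so
  \<open>expand_to_all\<close> may throw away all but one piece next to the cut. Relative density
  passes to one of the two pieces only, with no say in which; this may be the much shorter one, so
  that cuts could outweigh the factor \<beta>. Hence the separate
  \<open>expand_to_definite_length\<close>. Frobenius-Perron derivatives are arbitrarily chosen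
  versions, so stationarity is stated through integrals over sets, and pointwise values return only
  at the end, as one-sided limits of \<open>g\<close>.\<close>

section \<open>Functions of bounded variation\<close>

text \<open>Jordan decomposition with \<open>v\<close> the variation of \<open>g\<close> up to a
  point. Appending \<open>z\<close> to a chain that ends at \<open>y\<close> gains
  \<open>\<bar>g z - g y\<bar>\<close>, so \<open>v\<close> grows by at least the increment of
  \<open>g\<close> and by at least 0.\<close>

lemma bounded_variation_on_mono_decomposition:
  fixes g :: "real \<Rightarrow> real"
  assumes bv: "bounded_variation_on {a..b} g"
  obtains v where "mono_on {a..b} v" "mono_on {a..b} (\<lambda>x. v x - g x)"
proof -
  obtain V where V: "\<And>n x. strict_mono_on {..n} x \<Longrightarrow> x ` {..n} \<subseteq> {a..b} \<Longrightarrow>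
        (\<Sum>i<n. \<bar>g (x (Suc i)) - g (x i)\<bar>) \<le> V"
    using bv unfolding bounded_variation_on_def by blast
  \<comment> \<open>Only the last point of a chain is prescribed; it may start anywhere in
    \<open>{a..b}\<close>. The one-point chain keeps \<open>A y\<close> nonempty.\<close>
  define A where "A y = {(\<Sum>i<n. \<bar>g (x (Suc i)) - g (x i)\<bar>) | n x.
      strict_mono_on {..n} x \<and> x ` {..n} \<subseteq> {a..b} \<and> x n = y}" for y
  have bdd: "bdd_above (A y)" for y
    unfolding A_def by (rule bdd_aboveI[of _ V]) (auto intro: V)
  have ne: "A y \<noteq> {}" if "y \<in> {a..b}" for y
  proof -
    have "(\<Sum>i<0. \<bar>g ((\<lambda>_. y) (Suc i)) - g ((\<lambda>_. y) i)\<bar>) \<in> A y"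
      unfolding A_def using that by (intro CollectI exI[of _ 0] exI[of _ "\<lambda>_. y"]) (auto simp: strict_mono_on_def)
    then show ?thesis by auto
  qed
  have step: "Sup (A y) + \<bar>g z - g y\<bar> \<le> Sup (A z)" if "y \<in> {a..b}" "z \<in> {a..b}" "y < z" for y z
  proof -
    have "s \<le> Sup (A z) - \<bar>g z - g y\<bar>" if s_in: "s \<in> A y" for s
    proof -
      obtain n x where x: "strict_mono_on {..n} x" "x ` {..n} \<subseteq> {a..b}" "x n = y"
        and s: "s = (\<Sum>i<n. \<bar>g (x (Suc i)) - g (x i)\<bar>)"
        using s_in unfolding A_def by blast
      define x' where "x' = x(Suc n := z)"
      have xle: "x i \<le> y" if "i \<le> n" for i
      proof (cases "i = n")
        case False
        then have "x i < x n" using x(1) that by (auto simp: strict_mono_on_def)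
        then show ?thesis using x(3) by simp
      qed (use x in auto)
      have "strict_mono_on {..Suc n} x'"
        unfolding strict_mono_on_def
      proof (intro ballI impI allI)
        fix i j assume ij: "i \<in> {..Suc n} \<and> j \<in> {..Suc n} \<and> i < j"
        show "x' i < x' j"
        proof (cases "j = Suc n")
          case True
          then have "x i \<le> y" using ij xle by auto
          then show ?thesis using True ij \<open>y < z\<close> by (auto simp: x'_def)
        next
          case False
          then show ?thesis using x(1) ij by (auto simp: x'_def strict_mono_on_def)
        qed
      qed
      moreover have "x' ` {..Suc n} \<subseteq> {a..b}"
      proof
        fix t assume "t \<in> x' ` {..Suc n}"
        then obtain i where i: "i \<le> Suc n" "t = x' i" by auto
        show "t \<in> {a..b}"
        proof (cases "i = Suc n")
          case False
          then have "i \<le> n" "t = x i" using i by (auto simp: x'_def)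
          then show ?thesis using x(2) by blast
        qed (use i \<open>z \<in> {a..b}\<close> in \<open>simp add: x'_def\<close>)
      qed
      moreover have "(\<Sum>i<Suc n. \<bar>g (x' (Suc i)) - g (x' i)\<bar>) = s + \<bar>g z - g y\<bar>"
        using x(3) by (simp add: x'_def s)
      moreover have "x' (Suc n) = z" by (simp add: x'_def)
      ultimately have "s + \<bar>g z - g y\<bar> \<in> A z" unfolding A_def by (metis (mono_tags, lifting) mem_Collect_eq)
      then show ?thesis using cSup_upper[OF _ bdd] by force
    qed
    then have "Sup (A y) \<le> Sup (A z) - \<bar>g z - g y\<bar>"
      using ne[OF that(1)] by (intro cSup_least) auto
    then show ?thesis by simp
  qed
  show thesis
  proof (rule that[of "\<lambda>y. Sup (A y)"])
    have "Sup (A y) \<le> Sup (A z) \<and> Sup (A y) - g y \<le> Sup (A z) - g z" if "y \<in> {a..b}" "z \<in> {a..b}" "y \<le> z" for y z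
      using step[of y z] that by (cases "y = z") auto
    then show "mono_on {a..b} (\<lambda>y. Sup (A y))" "mono_on {a..b} (\<lambda>x. Sup (A x) - g x)"
      by (auto intro!: mono_onI)
  qed
qed

lemma mono_on_at_right_limit:
  fixes v :: "real \<Rightarrow> real"
  assumes v: "mono_on {a..b} v" and x: "a \<le> x" "x < b"
  shows "(v \<longlongrightarrow> Inf (v ` {x<..b})) (at_right x)"
proof (rule order_tendstoI)
  have bdd: "bdd_below (v ` {x<..b})"
    using x by (intro bdd_belowI[of _ "v a"]) (auto intro: mono_onD[OF v])
  fix l assume l: "l < Inf (v ` {x<..b})"
  have "eventually (\<lambda>y. y \<in> {x<..<b}) (at_right x)" using x by (rule_tac eventually_at_right_real) auto
  then show "eventually (\<lambda>y. l < v y) (at_right x)"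
  proof eventually_elim
    case (elim y)
    then have "Inf (v ` {x<..b}) \<le> v y" by (intro cINF_lower[OF bdd]) auto
    with l show ?case by simp
  qed
next
  fix u assume "Inf (v ` {x<..b}) < u"
  then obtain z where z: "z \<in> {x<..b}" "v z < u"
    using x cInf_lessD[of "v ` {x<..b}" u] by auto
  have "eventually (\<lambda>y. y \<in> {x<..<z}) (at_right x)" using z by (rule_tac eventually_at_right_real) auto
  then show "eventually (\<lambda>y. v y < u) (at_right x)"
  proof eventually_elim
    case (elim y)
    then have "v y \<le> v z" using z x by (intro mono_onD[OF v]) auto
    with z show ?case by simp
  qed
qed

lemma bounded_variation_on_at_right_limit:
  assumes "bounded_variation_on {a..b} g" "a \<le> x" "x < b"
  shows "\<exists>l. (g \<longlongrightarrow> l) (at_right x)"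
proof -
  obtain v where v: "mono_on {a..b} v" "mono_on {a..b} (\<lambda>x. v x - g x)"
    using bounded_variation_on_mono_decomposition[OF assms(1)] .
  have "((\<lambda>x. v x - (v x - g x)) \<longlongrightarrow> Inf (v ` {x<..b}) - Inf ((\<lambda>x. v x - g x) ` {x<..b})) (at_right x)"
    using v assms by (intro tendsto_diff mono_on_at_right_limit[of a b])
  then show ?thesis by auto
qed

text \<open>Exchanges left and right limits. Reversing a chain turns its increments into those of
  the reflected chain, up to sign.\<close>

lemma bounded_variation_on_reflect:
  fixes g :: "real \<Rightarrow> real"
  assumes "bounded_variation_on {a..b} g"
  shows "bounded_variation_on {- b..- a} (\<lambda>x. g (- x))"
proof -
  obtain V where V: "\<And>n x. strict_mono_on {..n} x \<Longrightarrow> x ` {..n} \<subseteq> {a..b} \<Longrightarrow>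
        (\<Sum>i<n. \<bar>g (x (Suc i)) - g (x i)\<bar>) \<le> V"
    using assms unfolding bounded_variation_on_def by blast
  show ?thesis unfolding bounded_variation_on_def
  proof (intro exI allI impI, elim conjE)
    fix n :: nat and x :: "nat \<Rightarrow> real"
    assume x: "strict_mono_on {..n} x" "x ` {..n} \<subseteq> {- b..- a}"
    define y where "y i = - x (n - i)" for i
    have "strict_mono_on {..n} y"
      unfolding strict_mono_on_def y_def
    proof (intro allI impI)
      fix i j assume "i \<in> {..n} \<and> j \<in> {..n} \<and> i < j"
      then have "n - j \<in> {..n}" "n - i \<in> {..n}" "n - j < n - i" by auto
      then have "x (n - j) < x (n - i)" using x(1) unfolding strict_mono_on_def by blast
      then show "- x (n - i) < - x (n - j)" by simp
    qed
    moreover have "y ` {..n} \<subseteq> {a..b}"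
    proof
      fix t assume "t \<in> y ` {..n}"
      then obtain i where "i \<le> n" "t = - x (n - i)" by (auto simp: y_def)
      moreover have "x (n - i) \<in> {-b..-a}" by (rule subsetD[OF x(2)]) simp
      ultimately show "t \<in> {a..b}" by auto
    qed
    ultimately have "(\<Sum>i<n. \<bar>g (y (Suc i)) - g (y i)\<bar>) \<le> V" by (rule V)
    also have "(\<Sum>i<n. \<bar>g (y (Suc i)) - g (y i)\<bar>) = (\<Sum>i<n. \<bar>g (- x (Suc i)) - g (- x i)\<bar>)"
    \<comment> \<open>Increment \<open>i\<close> of the reversed chain is increment
      \<open>n - Suc i\<close> of the original one, traversed backwards.\<close>
    proof (rule sum.reindex_bij_witness[of _ "\<lambda>i. n - Suc i" "\<lambda>i. n - Suc i"], goal_cases)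
      case (5 i)
      then have "Suc (n - Suc i) = n - i" by auto
      then show ?case by (simp add: y_def abs_minus_commute)
    qed auto
    finally show "(\<Sum>i<n. \<bar>g (- x (Suc i)) - g (- x i)\<bar>) \<le> V" .
  qed
qed

lemma bounded_variation_on_at_left_limit:
  fixes g :: "real \<Rightarrow> real"
  assumes "bounded_variation_on {a..b} g" "a < x" "x \<le> b"
  shows "\<exists>l. (g \<longlongrightarrow> l) (at_left x)"
proof -
  obtain l where "((\<lambda>x. g (- x)) \<longlongrightarrow> l) (at_right (- x))"
    using bounded_variation_on_at_right_limit[OF bounded_variation_on_reflect[OF assms(1)], of "- x"] assms by auto
  then show ?thesis
    by (auto simp: filterlim_at_left_to_right[of _ _ x])
qed

lemma bounded_variation_on_countable_discontinuities:
  fixes g :: "real \<Rightarrow> real"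
  assumes "bounded_variation_on {a..b} g"
  shows "countable {x \<in> {a<..<b}. \<not> isCont g x}"
proof -
  obtain v where v: "mono_on {a..b} v" "mono_on {a..b} (\<lambda>x. v x - g x)"
    using bounded_variation_on_mono_decomposition[OF assms(1)] .
  have "countable {x \<in> {a<..<b}. \<not> isCont v x}" "countable {x \<in> {a<..<b}. \<not> isCont (\<lambda>x. v x - g x) x}"
    by (intro mono_on_ctble_discont_open mono_on_subset[OF v(1)] mono_on_subset[OF v(2)]; auto)+
  moreover have "{x \<in> {a<..<b}. \<not> isCont g x} \<subseteq> {x \<in> {a<..<b}. \<not> isCont v x} \<union> {x \<in> {a<..<b}. \<not> isCont (\<lambda>x. v x - g x) x}"
  proof
    fix x assume x: "x \<in> {x \<in> {a<..<b}. \<not> isCont g x}"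
    have "isCont g x" if "isCont v x" "isCont (\<lambda>x. v x - g x) x"
      using continuous_diff[OF that] by simp
    then show "x \<in> {x \<in> {a<..<b}. \<not> isCont v x} \<union> {x \<in> {a<..<b}. \<not> isCont (\<lambda>x. v x - g x) x}" using x by auto
  qed
  ultimately show ?thesis by (meson countable_Un countable_subset)
qed

section \<open>Lebesgue measure on intervals\<close>

text \<open>A weak form of the Lebesgue density theorem, by outer regularity. Cover \<open>B\<close>
  by an open \<open>W\<close> that is barely larger; if every component interval of \<open>W\<close>
  missed \<open>B\<close> in more than the fraction \<delta>, summing over the countably many
  components would make \<open>W - B\<close> too large.\<close>

lemma ex_interval_almost_full:
  fixes B :: "real set"
  assumes B: "B \<in> sets borel" "B \<subseteq> {u<..<w}" and pos: "0 < measure lborel B" and d: "0 < \<delta>"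
  shows "\<exists>a b. u \<le> a \<and> a < b \<and> b \<le> w \<and> measure lborel ({a<..<b} - B) \<le> \<delta> * (b - a)"
proof (rule ccontr)
  assume contra: "\<not> ?thesis"
  have fin: "S \<subseteq> {u<..<w} \<Longrightarrow> S \<in> sets borel \<Longrightarrow> emeasure lborel S = ennreal (measure lborel S)" for S
    using emeasure_mono[of S "{u<..<w}" lborel] emeasure_lborel_Ioo[of u w] emeasure_lborel_Ioo[of u u]
    by (intro emeasure_eq_ennreal_measure) (cases "u \<le> w"; auto simp: top_unique)
  \<comment> \<open>The components will show that \<delta> times the measure of \<open>B\<close> is
    less than \<open>e\<close>; any positive \<open>e\<close> up to that product is
    contradictory.\<close>
  define e where "e = \<delta> * measure lborel B / 2"
  have "0 < e" using pos d by (simp add: e_def)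
  then obtain U where U: "open U" "B \<subseteq> U" "emeasure lborel (U - B) < e"
    using outer_regular_lborel[OF B(1)] by blast
  define W where "W = U \<inter> {u<..<w}"
  have W: "open W" "B \<subseteq> W" "W \<subseteq> {u<..<w}" using U B by (auto simp: W_def)
  have "emeasure lborel (W - B) \<le> emeasure lborel (U - B)" using U(1) B(1) by (intro emeasure_mono) (auto simp: W_def)
  with U have WB: "emeasure lborel (W - B) < e" by simp
  let ?C = "components W"
  have cC: "countable ?C"
  proof (rule countable_disjoint_open_subsets)
    show "open S" if "S \<in> ?C" for S using open_components[OF W(1) that] .
    show "disjoint ?C" unfolding disjoint_def by (metis components_nonoverlap)
  qed
  have int: "\<exists>a b. C = {a<..<b} \<and> u \<le> a \<and> a < b \<and> b \<le> w" if "C \<in> ?C" for C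
  proof -
    have C: "open C" "connected C" "C \<noteq> {}"
      using open_components[OF W(1) that] in_components_connected[OF that] in_components_nonempty[OF that] by simp_all
    have sub: "C \<subseteq> {u<..<w}" using in_components_subset[OF that] W(3) by blast
    have bdd: "bdd_below C" "bdd_above C"
      using sub by (meson bdd_below_mono bdd_below_Ioo, meson bdd_above_mono bdd_above_Ioo)
    have "C = {Inf C<..<Sup C}"
    proof (intro equalityI subsetI)
      fix x assume x: "x \<in> C"
      then obtain e where e: "e > 0" "ball x e \<subseteq> C" using C(1) by (meson openE)
      have "x - e/2 \<in> C" "x + e/2 \<in> C" using e by (auto simp: dist_real_def intro!: subsetD[OF e(2)])
      then have "Inf C \<le> x - e/2" "x + e/2 \<le> Sup C" using bdd by (auto intro: cInf_lower cSup_upper)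
      with e show "x \<in> {Inf C<..<Sup C}" by auto
    next
      fix x assume x: "x \<in> {Inf C<..<Sup C}"
      then obtain y z where "y \<in> C" "y < x" "z \<in> C" "x < z"
        using cInf_lessD[OF C(3), of x] less_cSupD[OF C(3), of x] by auto
      then show "x \<in> C" using connectedD_interval[OF C(2), of y z x] by auto
    qed
    moreover have "u \<le> Inf C" using sub C(3) by (intro cInf_greatest) auto
    moreover have "Sup C \<le> w" using sub C(3) by (intro cSup_least) auto
    moreover have "Inf C < Sup C" using calculation(1) C(3) by (metis greaterThanLessThan_empty_iff not_le)
    ultimately show ?thesis by blast
  qed
  have CS: "C \<in> sets borel" if "C \<in> ?C" for C
    using open_components[OF W(1) that] by simp
  have disj: "disjoint_family_on (\<lambda>C. C) ?C" "disjoint_family_on (\<lambda>C. C - B) ?C"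
  proof -
    have *: "C \<inter> C' = {}" if "C \<in> ?C" "C' \<in> ?C" "C \<noteq> C'" for C C'
      using components_nonoverlap[OF that(1,2)] that(3) by simp
    show "disjoint_family_on (\<lambda>C. C) ?C" unfolding disjoint_family_on_def by (intro ballI impI *)
    show "disjoint_family_on (\<lambda>C. C - B) ?C" unfolding disjoint_family_on_def
    proof (intro ballI impI)
      fix C C' assume "C \<in> ?C" "C' \<in> ?C" "C \<noteq> C'"
      from *[OF this] show "(C - B) \<inter> (C' - B) = {}" by blast
    qed
  qed
  have le: "\<delta> * emeasure lborel C \<le> emeasure lborel (C - B)" if C: "C \<in> ?C" for C
  proof -
    obtain a b where ab: "C = {a<..<b}" "u \<le> a" "a < b" "b \<le> w" using int[OF C] by auto
    then have "measure lborel ({a<..<b} - B) > \<delta> * (b - a)" using contra by (meson not_le)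
    then show ?thesis using d ab B by (subst fin) (auto simp: ennreal_mult[symmetric])
  qed
  have "\<delta> * emeasure lborel W = \<delta> * emeasure lborel (\<Union>C\<in>?C. C)" by (simp add: Union_components)
  also have "\<dots> = \<delta> * (\<integral>\<^sup>+ C. emeasure lborel C \<partial>count_space ?C)"
    using cC disj(1) CS by (subst emeasure_UN_countable) auto
  also have "\<dots> = (\<integral>\<^sup>+ C. \<delta> * emeasure lborel C \<partial>count_space ?C)" by (simp add: nn_integral_cmult)
  also have "\<dots> \<le> (\<integral>\<^sup>+ C. emeasure lborel (C - B) \<partial>count_space ?C)"
    by (intro nn_integral_mono) (auto intro: le)
  also have "\<dots> = emeasure lborel (\<Union>C\<in>?C. C - B)"
    using cC disj(2) CS B by (subst emeasure_UN_countable) auto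
  also have "(\<Union>C\<in>?C. C - B) = W - B" using Union_components[of W] by blast
  finally have "\<delta> * emeasure lborel W < e" using WB by simp
  moreover have "\<delta> * emeasure lborel B \<le> \<delta> * emeasure lborel W"
    using W by (intro mult_left_mono emeasure_mono) auto
  ultimately have "\<delta> * emeasure lborel B < e" by simp
  then have "ennreal (\<delta> * measure lborel B) < ennreal e"
    using d B by (subst (asm) fin) (auto simp: ennreal_mult)
  then have "\<delta> * measure lborel B < e" using d by (subst (asm) ennreal_less_iff) auto
  moreover have "\<delta> * measure lborel B > 0" using d pos by simp
  ultimately show False by (simp add: e_def)
qed

lemma emeasure_lborel_vimage_affine:
  fixes c t :: real
  assumes "S \<in> sets borel" "c > 0"
  shows "emeasure lborel S = ennreal c * emeasure lborel ((\<lambda>x. c * x - t) -` S)"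
proof -
  have [measurable]: "(\<lambda>x::real. - t + c * x) \<in> borel_measurable borel" by simp
  have "emeasure lborel S = emeasure (density (distr lborel borel (\<lambda>x. - t + c * x)) (\<lambda>_. ennreal (abs c))) S"
    by (subst lborel_real_affine[of c "- t"]) (use assms in auto)
  also have "\<dots> = ennreal c * emeasure lborel ((\<lambda>x. - t + c * x) -` S)"
    using assms by (simp add: emeasure_density_const emeasure_distr)
  finally show ?thesis by (simp add: algebra_simps)
qed

section \<open>The greedy and lazy maps\<close>

locale random_beta =
  fixes \<beta> p :: real
  assumes beta_gt_1: "\<beta> > 1" and beta_not_int: "\<beta> \<notin> \<int>" and p_pos: "0 < p" and p_less_1: "p < 1"
begin

abbreviation "k \<equiv> \<lfloor>\<beta>\<rfloor>"
definition "M = of_int k / (\<beta> - 1)"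

lemma J_eq: "J \<beta> = {0..M}" by (simp add: J_def M_def)

lemma k_ge_1: "k \<ge> 1" using beta_gt_1 by (simp add: le_floor_iff)

lemma k_bounds: "of_int k < \<beta>" "\<beta> < of_int k + 1"
proof -
  have "of_int k \<noteq> \<beta>" using beta_not_int by (metis Ints_of_int)
  then show "of_int k < \<beta>" using of_int_floor_le[of \<beta>] by linarith
  show "\<beta> < of_int k + 1" by simp
qed

text \<open>\<open>M\<close> is the fixed point of the branch with digit \<open>k\<close>; hence the
  reflection at \<open>M / 2\<close> carries the branch with digit \<open>d\<close> to the one with
  digit \<open>k - d\<close>.\<close>

lemma M_mult: "\<beta> * M = M + of_int k"
  using beta_gt_1 by (simp add: M_def field_simps)

text \<open>Greedy branches with digit below \<open>k\<close> take values below 1; this inequality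
  keeps them inside \<open>{0..M}\<close>.\<close>

lemma M_gt_1: "M > 1"
  using beta_gt_1 k_bounds by (simp add: M_def field_simps)

lemma reflect_eq: "reflect \<beta> x = M - x" by (simp add: reflect_def M_def)

lemma greedy_cell_iff:
  assumes "x \<in> {0..M}" "d \<in> {0..k}"
  shows "x \<in> greedy_cell \<beta> d \<longleftrightarrow> d = min k \<lfloor>\<beta> * x\<rfloor>"
proof -
  have b: "\<beta> > 0" using beta_gt_1 by simp
  have "x \<in> greedy_cell \<beta> d \<longleftrightarrow> (if d = k then of_int k \<le> \<beta> * x else of_int d \<le> \<beta> * x \<and> \<beta> * x < of_int d + 1)"
    using assms b by (auto simp: greedy_cell_def M_def pos_divide_le_eq pos_less_divide_eq mult.commute)
  also have "\<dots> \<longleftrightarrow> d = min k \<lfloor>\<beta> * x\<rfloor>"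
  proof (cases "d = k")
    case True
    then show ?thesis using le_floor_iff[of k "\<beta> * x"] by auto
  next
    case False
    then have "d < k" using assms(2) by auto
    then have "d = min k \<lfloor>\<beta> * x\<rfloor> \<longleftrightarrow> \<lfloor>\<beta> * x\<rfloor> = d" by auto
    then show ?thesis using False floor_eq_iff[of "\<beta> * x" d] by simp
  qed
  finally show ?thesis .
qed

text \<open>The cap matters on the last greedy cell: \<open>\<beta> * M = M + k\<close> exceeds
  \<open>k + 1\<close>, so the floor runs past the largest digit there.\<close>

definition "digit x = min k \<lfloor>\<beta> * x\<rfloor>"

lemma digit_bounds: "x \<in> {0..M} \<Longrightarrow> digit x \<in> {0..k}"
  using k_ge_1 beta_gt_1 by (auto simp: digit_def)

lemma greedy_map_eq: "x \<in> {0..M} \<Longrightarrow> greedy_map \<beta> x = \<beta> * x - of_int (digit x)"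
  unfolding greedy_map_def using greedy_cell_iff digit_bounds
  by (subst the_equality[where a = "digit x"]) (auto simp: digit_def)

lemma lazy_cell_iff:
  assumes "x \<in> {0..M}" "d \<in> {0..k}"
  shows "x \<in> lazy_cell \<beta> d \<longleftrightarrow> d = k - digit (M - x)"
proof -
  have "x \<in> lazy_cell \<beta> d \<longleftrightarrow> M - x \<in> greedy_cell \<beta> (k - d)"
    unfolding lazy_cell_def reflect_eq[abs_def] by force
  also have "\<dots> \<longleftrightarrow> d = k - digit (M - x)"
    using assms by (subst greedy_cell_iff) (auto simp: digit_def)
  finally show ?thesis .
qed

lemma lazy_map_eq: 
  assumes "x \<in> {0..M}" 
  shows "lazy_map \<beta> x = \<beta> * x - of_int (k - digit (M - x))"
proof -
  have "digit (M - x) \<in> {0..k}" using digit_bounds assms by auto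
  then have "(THE d. d \<in> {0..k} \<and> x \<in> lazy_cell \<beta> d) = k - digit (M - x)"
    using lazy_cell_iff[OF assms] by (intro the_equality) auto
  then show ?thesis unfolding lazy_map_def by simp
qed

text \<open>Lets later facts on lazy branches be obtained by reflecting greedy ones. It rests on
  \<open>M_mult\<close>.\<close>

lemma lazy_map_conj:
  assumes "x \<in> {0..M}"
  shows "lazy_map \<beta> x = M - greedy_map \<beta> (M - x)"
  using assms M_mult by (subst lazy_map_eq, simp, subst greedy_map_eq, simp) (simp add: algebra_simps)

text \<open>Indexing the two maps by the coin symbol turns each average over the maps into a sum
  over \<open>bool\<close>.\<close>

definition branch :: "bool \<Rightarrow> real \<Rightarrow> real" where
  "branch i = (if i then greedy_map \<beta> else lazy_map \<beta>)"

definition weight :: "bool \<Rightarrow> real" where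
  "weight i = (if i then p else 1 - p)"

lemma weight_pos: "weight i > 0" using p_pos p_less_1 by (simp add: weight_def)

lemma greedy_map_range: 
  assumes x: "x \<in> {0..M}" shows "greedy_map \<beta> x \<in> {0..M}"
proof -
  have "\<beta> * x \<le> \<beta> * M" using x beta_gt_1 by (intro mult_left_mono) auto
  then have 1: "\<beta> * x \<le> M + of_int k" using M_mult by simp
  show ?thesis unfolding greedy_map_eq[OF x]
  proof (cases "k \<le> \<lfloor>\<beta> * x\<rfloor>")
    case True
    then have "digit x = k" "of_int k \<le> \<beta> * x" by (auto simp: digit_def le_floor_iff)
    then show "\<beta> * x - of_int (digit x) \<in> {0..M}" using 1 by auto
  next
    case False
    then have "digit x = \<lfloor>\<beta> * x\<rfloor>" by (auto simp: digit_def)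
    then show "\<beta> * x - of_int (digit x) \<in> {0..M}" using M_gt_1 of_int_floor_le[of "\<beta>*x"] floor_correct[of "\<beta> * x"]
      by auto linarith
  qed
qed

lemma branch_range: "x \<in> {0..M} \<Longrightarrow> branch i x \<in> {0..M}"
  using greedy_map_range[of x] greedy_map_range[of "M - x"] by (auto simp: branch_def lazy_map_conj)

lemma branch_affine: 
  assumes "x \<in> {0..M}" 
  shows "\<exists>d\<in>{0..k}. branch i x = \<beta> * x - of_int d"
proof (cases i)
  case True
  then show ?thesis using assms greedy_map_eq digit_bounds by (auto simp: branch_def)
next
  case False
  have "k - digit (M - x) \<in> {0..k}" using digit_bounds[of "M - x"] assms by auto
  then show ?thesis using False assms lazy_map_eq[OF assms] by (auto simp: branch_def intro!: bexI[of _ "k - digit (M - x)"])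
qed

section \<open>Normalized Lebesgue measure and nonsingularity of the two maps\<close>

lemma space_lambda [simp]: "space (lambda \<beta>) = {0..M}"
  by (simp add: lambda_def J_eq)

lemma sets_lambda [measurable_cong]: "sets (lambda \<beta>) = sets (restrict_space borel {0..M})"
  by (simp add: lambda_def J_eq sets_restrict_space)

lemma sets_lambda_iff: "B \<in> sets (lambda \<beta>) \<longleftrightarrow> B \<in> sets borel \<and> B \<subseteq> {0..M}"
  unfolding sets_lambda by (subst sets_restrict_space_iff) auto

lemma borel_measurable_lambda: "f \<in> borel_measurable borel \<Longrightarrow> f \<in> borel_measurable (lambda \<beta>)"
  by (subst measurable_cong_sets[OF sets_lambda refl]) (rule measurable_restrict_space1)

lemma emeasure_lambda:
  assumes "B \<in> sets (lambda \<beta>)"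
  shows "emeasure (lambda \<beta>) B = emeasure lborel B / ennreal M"
proof -
  have J: "{0..M} \<in> sets (restrict_space lborel {0..M})" by (simp add: sets_restrict_space_iff)
  have B: "B \<in> sets (restrict_space lborel {0..M})" "B \<subseteq> {0..M}"
    using assms by (auto simp: sets_lambda_iff sets_restrict_space_iff)
  have "emeasure (lambda \<beta>) B = emeasure (restrict_space lborel {0..M}) ({0..M} \<inter> B) / emeasure (restrict_space lborel {0..M}) {0..M}"
    unfolding lambda_def J_eq using J B by simp
  also have "\<dots> = emeasure lborel B / ennreal M"
    using B M_gt_1 by (simp add: emeasure_restrict_space Int_absorb1)
  finally show ?thesis .
qed

lemma prob_space_lambda: "prob_space (lambda \<beta>)"
proof
  have "emeasure (lambda \<beta>) {0..M} = ennreal M / ennreal M"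
    using M_gt_1 by (subst emeasure_lambda) (auto simp: sets_lambda_iff)
  also have "\<dots> = 1" using M_gt_1 by (simp add: divide_ennreal)
  finally show "emeasure (lambda \<beta>) (space (lambda \<beta>)) = 1" by simp
qed

sublocale lam: prob_space "lambda \<beta>" by (rule prob_space_lambda)

lemma null_sets_lambda_iff: "N \<in> null_sets (lambda \<beta>) \<longleftrightarrow> N \<in> null_sets lborel \<and> N \<subseteq> {0..M}"
  using M_gt_1 by (auto simp: null_sets_def sets_lambda_iff emeasure_lambda ennreal_divide_eq_0_iff)

lemma measurable_digit: "digit \<in> measurable borel (count_space UNIV)"
  unfolding digit_def by measurable

lemma measurable_branch: "branch i \<in> measurable (lambda \<beta>) (lambda \<beta>)"
proof -
  have [measurable]: "digit \<in> measurable borel (count_space UNIV)" by (rule measurable_digit)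
  have "branch i \<in> measurable (lambda \<beta>) borel"
  proof (cases i)
    case True
    have "(\<lambda>x. \<beta> * x - real_of_int (digit x)) \<in> borel_measurable borel" by measurable
    from borel_measurable_lambda[OF this] show ?thesis
      by (rule measurable_cong[THEN iffD2, rotated]) (auto simp: True branch_def greedy_map_eq)
  next
    case False
    have "(\<lambda>x. \<beta> * x - real_of_int (k - digit (M - x))) \<in> borel_measurable borel" by measurable
    from borel_measurable_lambda[OF this] show ?thesis
      by (rule measurable_cong[THEN iffD2, rotated]) (auto simp: False branch_def lazy_map_eq)
  qed
  then have "branch i \<in> measurable (lambda \<beta>) (restrict_space borel {0..M})"
    by (rule measurable_restrict_space2[rotated]) (use branch_range in auto)
  then show ?thesis by (subst measurable_cong_sets[OF refl sets_lambda])
qed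

lemma branch_vimage_sets: "B \<in> sets (lambda \<beta>) \<Longrightarrow> branch i -` B \<inter> {0..M} \<in> sets (lambda \<beta>)"
  using measurable_sets[OF measurable_branch] by auto

text \<open>Nonsingularity: at each point a branch coincides with one of \<open>k + 1\<close> affine
  maps of slope \<beta>, so the preimage lies in finitely many affine preimages, each of them
  null.\<close>

lemma branch_null_sets:
  assumes N: "N \<in> null_sets (lambda \<beta>)"
  shows "branch i -` N \<inter> {0..M} \<in> null_sets (lambda \<beta>)"
proof -
  have N': "N \<in> sets borel" "emeasure lborel N = 0"
    using N[unfolded null_sets_lambda_iff] by (auto simp: null_sets_def)
  have "(\<lambda>x. \<beta> * x - of_int d) -` N \<in> null_sets lborel" for d
  proof (rule null_setsI)
    have "(\<lambda>x. \<beta> * x - of_int d) -` N \<inter> space borel \<in> sets borel"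
      by (rule measurable_sets[OF _ N'(1)]) simp
    then show "(\<lambda>x. \<beta> * x - of_int d) -` N \<in> sets lborel" by simp
    have "ennreal \<beta> * emeasure lborel ((\<lambda>x. \<beta> * x - of_int d) -` N) = 0"
      using emeasure_lborel_vimage_affine[OF N'(1), of \<beta> "of_int d"] N'(2) beta_gt_1 by simp
    then show "emeasure lborel ((\<lambda>x. \<beta> * x - of_int d) -` N) = 0"
      using beta_gt_1 by simp
  qed
  then have U: "(\<Union>d\<in>{0..k}. (\<lambda>x. \<beta> * x - of_int d) -` N) \<in> null_sets lborel"
    by (intro null_sets_UN') auto
  have S: "branch i -` N \<inter> {0..M} \<subseteq> (\<Union>d\<in>{0..k}. (\<lambda>x. \<beta> * x - of_int d) -` N)"
  proof
    fix x assume "x \<in> branch i -` N \<inter> {0..M}"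
    then show "x \<in> (\<Union>d\<in>{0..k}. (\<lambda>x. \<beta> * x - of_int d) -` N)"
      using branch_affine[of x i] by auto
  qed
  have "branch i -` N \<inter> {0..M} \<in> sets lborel"
    using branch_vimage_sets[of N] N by (auto simp: sets_lambda_iff)
  from null_sets_subset[OF U this S] show ?thesis unfolding null_sets_lambda_iff by simp
qed

lemma AE_branch:
  assumes "AE x in lambda \<beta>. Q x"
  shows "AE x in lambda \<beta>. Q (branch i x)"
proof -
  obtain N where N: "N \<in> null_sets (lambda \<beta>)" "{x \<in> {0..M}. \<not> Q x} \<subseteq> N"
    using assms by (auto simp: eventually_ae_filter)
  show ?thesis
    by (rule AE_I'[OF branch_null_sets[OF N(1)]]) (use N(2) branch_range in auto)
qed

end

section \<open>The Frobenius-Perron operator and stationarity\<close>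

text \<open>Justifies the \<open>SOME\<close> in the definition. The image under \<open>T\<close> of
  the measure with density \<open>f\<close> is finite, and nonsingularity makes it absolutely
  continuous; its Radon-Nikodym derivative is a witness.\<close>

lemma frobenius_perron_spec:
  fixes f :: "'a \<Rightarrow> real"
  assumes "sigma_finite_measure M" and T: "T \<in> measurable M M"
    and nonsing: "\<And>N. N \<in> null_sets M \<Longrightarrow> T -` N \<inter> space M \<in> null_sets M"
    and f: "integrable M f" "AE x in M. 0 \<le> f x"
  shows "integrable M (frobenius_perron M T f)"
    and "\<And>B. B \<in> sets M \<Longrightarrow>
      (LINT x:B|M. frobenius_perron M T f x) = (LINT x:(T -` B \<inter> space M)|M. f x)"
proof -
  interpret sigma_finite_measure M by fact
  have [measurable]: "f \<in> borel_measurable M" using f by auto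
  define N where "N = distr (density M (\<lambda>x. ennreal (f x))) M T"
  have T': "T \<in> measurable (density M (\<lambda>x. ennreal (f x))) M" using T by simp
  have eN: "emeasure N B = (\<integral>\<^sup>+x. ennreal (indicator (T -` B \<inter> space M) x * f x) \<partial>M)" if "B \<in> sets M" for B
  proof -
    have "emeasure N B = (\<integral>\<^sup>+x. ennreal (f x) * indicator (T -` B \<inter> space M) x \<partial>M)"
      unfolding N_def using that measurable_sets[OF T that]
      by (subst emeasure_distr[OF T']) (auto simp: emeasure_density)
    then show ?thesis by (auto intro!: nn_integral_cong simp: indicator_def)
  qed
  have int_ind: "integrable M (\<lambda>x. indicator B x * h x)" if "B \<in> sets M" "integrable M h" for B and h :: "'a \<Rightarrow> real"
    using integrable_mult_indicator[OF that] by simp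
  have eN': "emeasure N B = ennreal (LINT x:(T -` B \<inter> space M)|M. f x)" if "B \<in> sets M" for B
    unfolding eN[OF that] set_lebesgue_integral_def real_scaleR_def
    using measurable_sets[OF T that] f
    by (intro nn_integral_eq_integral int_ind) auto
  have "finite_measure N"
    by (rule finite_measureI) (simp add: eN' N_def[THEN arg_cong[where f = space]])
  moreover have "absolutely_continuous M N"
    unfolding absolutely_continuous_def
  proof
    fix B assume B: "B \<in> null_sets M"
    then have "(\<integral>\<^sup>+x. ennreal (indicator (T -` B \<inter> space M) x * f x) \<partial>M) = (\<integral>\<^sup>+x. 0 \<partial>M)"
      using AE_not_in[OF nonsing[OF B]] by (intro nn_integral_cong_AE) (auto simp: indicator_def)
    then show "B \<in> null_sets N" using B eN[of B] by (auto simp: null_sets_def N_def)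
  qed
  moreover have sN: "sets N = sets M" by (simp add: N_def)
  ultimately obtain D where D: "D \<in> borel_measurable M" "AE x in M. RN_deriv M N x = ennreal (D x)"
      "\<And>x. 0 \<le> D x" and ac: "absolutely_continuous M N"
    using real_RN_deriv by metis
  have "density M (\<lambda>x. ennreal (D x)) = density M (RN_deriv M N)"
    using D by (intro density_cong) auto
  then have DN: "density M (\<lambda>x. ennreal (D x)) = N" using density_RN_deriv[OF ac sN] by simp
  have nD: "(\<integral>\<^sup>+x. ennreal (indicator B x * D x) \<partial>M) = ennreal (LINT x:(T -` B \<inter> space M)|M. f x)"
    if "B \<in> sets M" for B
  proof -
    have "(\<integral>\<^sup>+x. ennreal (indicator B x * D x) \<partial>M) = emeasure (density M (\<lambda>x. ennreal (D x))) B"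
      using that D by (subst emeasure_density) (auto intro!: nn_integral_cong simp: indicator_def)
    then show ?thesis using eN'[OF that] DN by simp
  qed
  have intD: "integrable M D"
  proof (rule integrableI_nonneg)
    have "(\<integral>\<^sup>+x. ennreal (D x) \<partial>M) = (\<integral>\<^sup>+x. ennreal (indicator (space M) x * D x) \<partial>M)"
      by (auto intro!: nn_integral_cong)
    then show "(\<integral>\<^sup>+x. ennreal (D x) \<partial>M) < \<infinity>" using nD[of "space M"] by simp
  qed (use D in auto)
  have "(LINT x:B|M. D x) = (LINT x:(T -` B \<inter> space M)|M. f x)" if B: "B \<in> sets M" for B
  proof -
    have "ennreal (LINT x:B|M. D x) = ennreal (LINT x:(T -` B \<inter> space M)|M. f x)"
      unfolding nD[OF B, symmetric] unfolding set_lebesgue_integral_def real_scaleR_def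
      using D by (intro nn_integral_eq_integral[symmetric] int_ind B intD) auto
    moreover have "0 \<le> (LINT x:B|M. D x)" "0 \<le> (LINT x:(T -` B \<inter> space M)|M. f x)"
      unfolding set_lebesgue_integral_def using D f by (auto intro!: integral_nonneg_AE)
    ultimately show ?thesis by simp
  qed
  with intD have "\<exists>G. integrable M G \<and> (\<forall>B\<in>sets M. (LINT x:B|M. G x) = (LINT x:(T -` B \<inter> space M)|M. f x))"
    by blast
  from someI_ex[OF this] show "integrable M (frobenius_perron M T f)"
    "\<And>B. B \<in> sets M \<Longrightarrow>
      (LINT x:B|M. frobenius_perron M T f x) = (LINT x:(T -` B \<inter> space M)|M. f x)"
    unfolding frobenius_perron_def by auto
qed

lemma set_integrable_of_integrable:
  fixes f :: "'a \<Rightarrow> real"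
  assumes "integrable M f" "B \<in> sets M"
  shows "set_integrable M B f"
  using integrable_mult_indicator[OF assms(2,1)] by (simp add: set_integrable_def)

lemma L1_limit_set_integral:
  assumes lim: "L1_limit M F g" and F: "\<And>n. integrable M (F n)" and B: "B \<in> sets M"
  shows "(\<lambda>n. LINT x:B|M. F n x) \<longlonglongrightarrow> (LINT x:B|M. g x)"
proof -
  have g: "integrable M g" and l: "(\<lambda>n. \<integral>\<^sup>+ x. ennreal \<bar>F n x - g x\<bar> \<partial>M) \<longlonglongrightarrow> 0"
    using lim by (auto simp: L1_limit_def)
  have "(\<lambda>n. ennreal (\<integral>x. \<bar>F n x - g x\<bar> \<partial>M)) \<longlonglongrightarrow> ennreal 0"
    using l F g by (subst (asm) nn_integral_eq_integral) auto
  then have l': "(\<lambda>n. \<integral>x. \<bar>F n x - g x\<bar> \<partial>M) \<longlonglongrightarrow> 0"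
    by (subst (asm) tendsto_ennreal_iff) auto
  have "\<bar>(LINT x:B|M. F n x) - (LINT x:B|M. g x)\<bar> \<le> (\<integral>x. \<bar>F n x - g x\<bar> \<partial>M)" for n
  proof -
    have "(LINT x:B|M. F n x) - (LINT x:B|M. g x) = (LINT x:B|M. F n x - g x)"
      using set_integrable_of_integrable[OF F B] set_integrable_of_integrable[OF g B] by simp
    also have "\<bar>\<dots>\<bar> \<le> (\<integral>x. \<bar>indicator B x *\<^sub>R (F n x - g x)\<bar> \<partial>M)"
      unfolding set_lebesgue_integral_def by (rule integral_abs_bound)
    also have "\<dots> \<le> (\<integral>x. \<bar>F n x - g x\<bar> \<partial>M)"
      by (intro integral_mono integrable_abs integrable_mult_indicator B Bochner_Integration.integrable_diff F g)
        (auto simp: indicator_def)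
    finally show ?thesis .
  qed
  then have "(\<lambda>n. (LINT x:B|M. F n x) - (LINT x:B|M. g x)) \<longlonglongrightarrow> 0"
    using l' by (intro Lim_null_comparison[OF _ l']) auto
  then show ?thesis using LIM_zero_iff by blast
qed

context random_beta
begin

lemma random_operator_spec:
  assumes f: "integrable (lambda \<beta>) f" "AE x in lambda \<beta>. 0 \<le> f x"
  shows "integrable (lambda \<beta>) (random_operator \<beta> p f)"
    and "AE x in lambda \<beta>. 0 \<le> random_operator \<beta> p f x"
    and "\<And>B. B \<in> sets (lambda \<beta>) \<Longrightarrow> (LINT x:B|lambda \<beta>. random_operator \<beta> p f x) =
      (\<Sum>i\<in>UNIV. weight i * (LINT x:(branch i -` B \<inter> {0..M})|lambda \<beta>. f x))"
proof -
  let ?l = "lambda \<beta>"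
  define G where "G i = frobenius_perron ?l (branch i) f" for i
  have G: "integrable ?l (G i)" "B \<in> sets ?l \<Longrightarrow> (LINT x:B|?l. G i x) = (LINT x:(branch i -` B \<inter> {0..M})|?l. f x)" for i B
    using frobenius_perron_spec[OF lam.sigma_finite_measure measurable_branch _ f] branch_null_sets
    unfolding G_def by auto
  have R: "random_operator \<beta> p f = (\<lambda>x. p * G True x + (1 - p) * G False x)"
    by (simp add: random_operator_def G_def branch_def)
  show int: "integrable ?l (random_operator \<beta> p f)" unfolding R using G(1) by auto
  show eq: "(LINT x:B|?l. random_operator \<beta> p f x) =
      (\<Sum>i\<in>UNIV. weight i * (LINT x:(branch i -` B \<inter> {0..M})|?l. f x))" if "B \<in> sets ?l" for B
  proof -
    have "(LINT x:B|?l. random_operator \<beta> p f x) = p * (LINT x:B|?l. G True x) + (1 - p) * (LINT x:B|?l. G False x)"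
      unfolding R using set_integrable_of_integrable[OF G(1) that] by simp
    then show ?thesis by (simp add: UNIV_bool weight_def G(2)[OF that])
  qed
  show "AE x in ?l. 0 \<le> random_operator \<beta> p f x"
  \<comment> \<open>An arbitrary version carries its sign only almost everywhere; it is read off
    from the integrals over all measurable sets.\<close>
  proof (rule lam.density_nonneg[OF int])
    fix E assume "E \<in> sets ?l"
    then show "0 \<le> (LINT x:E|?l. random_operator \<beta> p f x)"
      using f weight_pos unfolding eq[OF \<open>E \<in> sets ?l\<close>] unfolding set_lebesgue_integral_def
      by (intro sum_nonneg mult_nonneg_nonneg integral_nonneg_AE) (auto intro: less_imp_le)
  qed
qed

section \<open>Cesaro averages and stationarity of their limit\<close>

definition iter :: "nat \<Rightarrow> real \<Rightarrow> real" where
  "iter j = (random_operator \<beta> p ^^ j) (\<lambda>_. 1)"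

lemma iter_spec: "integrable (lambda \<beta>) (iter j) \<and> (AE x in lambda \<beta>. 0 \<le> iter j x)
   \<and> (LINT x:{0..M}|lambda \<beta>. iter j x) = 1"
proof (induction j)
  case 0
  have "(LINT x:{0..M}|lambda \<beta>. (1::real)) = measure (lambda \<beta>) {0..M}"
    by (simp add: set_lebesgue_integral_def)
  then show ?case using lam.prob_space by (simp add: iter_def)
next
  case (Suc j)
  have eq: "iter (Suc j) = random_operator \<beta> p (iter j)" by (simp add: iter_def)
  have S: "{0..M} \<in> sets (lambda \<beta>)" using sets.top[of "lambda \<beta>"] by simp
  \<comment> \<open>Mass is preserved because both maps send \<open>{0..M}\<close> into itself and
    the weights add up to 1.\<close>
  have "branch i -` {0..M} \<inter> {0..M} = {0..M}" for i using branch_range by auto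
  then show ?case unfolding eq
    using random_operator_spec[of "iter j"] Suc S by (simp add: UNIV_bool weight_def)
qed

lemma set_integral_iter_bounds:
  assumes "B \<in> sets (lambda \<beta>)"
  shows "0 \<le> (LINT x:B|lambda \<beta>. iter j x)" "(LINT x:B|lambda \<beta>. iter j x) \<le> 1"
proof -
  have i: "integrable (lambda \<beta>) (iter j)" "AE x in lambda \<beta>. 0 \<le> iter j x" using iter_spec by auto
  show "0 \<le> (LINT x:B|lambda \<beta>. iter j x)"
    unfolding set_lebesgue_integral_def using i by (auto intro!: integral_nonneg_AE)
  have S: "{0..M} \<in> sets (lambda \<beta>)" using sets.top[of "lambda \<beta>"] by simp
  have "(LINT x:B|lambda \<beta>. iter j x) \<le> (LINT x:{0..M}|lambda \<beta>. iter j x)"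
    unfolding set_lebesgue_integral_def using i assms S
    by (intro integral_mono_AE integrable_mult_indicator) (auto simp: indicator_def sets_lambda_iff)
  then show "(LINT x:B|lambda \<beta>. iter j x) \<le> 1" using iter_spec by simp
qed

lemma set_integral_cesaro:
  assumes "B \<in> sets (lambda \<beta>)"
  shows "(LINT x:B|lambda \<beta>. cesaro \<beta> p n x) = (\<Sum>j<n. LINT x:B|lambda \<beta>. iter j x) / real n"
proof -
  have "(LINT x:B|lambda \<beta>. cesaro \<beta> p n x) = (1 / real n) * (LINT x:B|lambda \<beta>. (\<Sum>j<n. iter j x))"
    unfolding cesaro_def iter_def by simp
  also have "(LINT x:B|lambda \<beta>. (\<Sum>j<n. iter j x)) = (\<Sum>j<n. LINT x:B|lambda \<beta>. iter j x)"
    unfolding set_lebesgue_integral_def scaleR_sum_right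
    using assms iter_spec by (intro Bochner_Integration.integral_sum integrable_mult_indicator) auto
  finally show ?thesis by simp
qed

lemma integrable_cesaro: "integrable (lambda \<beta>) (cesaro \<beta> p n)"
  using iter_spec unfolding cesaro_def iter_def[symmetric] by auto

end

locale limit_density = random_beta +
  fixes g :: "real \<Rightarrow> real"
  assumes limit: "bv_limit_density \<beta> p g"
begin

lemma bv: "bounded_variation_on {0..M} g" and L1: "L1_limit (lambda \<beta>) (cesaro \<beta> p) g"
  using limit by (auto simp: bv_limit_density_def J_eq)

lemma integrable_g: "integrable (lambda \<beta>) g" using L1 by (simp add: L1_limit_def)

lemma cesaro_limit: "B \<in> sets (lambda \<beta>) \<Longrightarrow> (\<lambda>n. LINT x:B|lambda \<beta>. cesaro \<beta> p n x) \<longlonglongrightarrow> (LINT x:B|lambda \<beta>. g x)"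
  by (rule L1_limit_set_integral[OF L1 integrable_cesaro])

text \<open>Applying the operator to the average of the first \<open>n\<close> iterates shifts the
  sum by one index; only the boundary terms \<open>a n - a 0\<close> survive. They are bounded by 2
  and vanish after division by \<open>n\<close>.\<close>

lemma g_stationary:
  assumes B: "B \<in> sets (lambda \<beta>)"
  shows "(\<Sum>i\<in>UNIV. weight i * (LINT x:(branch i -` B \<inter> {0..M})|lambda \<beta>. g x)) = (LINT x:B|lambda \<beta>. g x)"
proof -
  define a where "a j = (LINT x:B|lambda \<beta>. iter j x)" for j
  let ?C = "\<lambda>n B. LINT x:B|lambda \<beta>. cesaro \<beta> p n x"
  have a: "\<bar>a j\<bar> \<le> 1" for j using set_integral_iter_bounds[OF B, of j] by (simp add: a_def)
  have step: "(\<Sum>i\<in>UNIV. weight i * (LINT x:(branch i -` B \<inter> {0..M})|lambda \<beta>. iter j x)) = a (Suc j)" for j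
    using random_operator_spec(3)[OF _ _ B, of "iter j"] iter_spec[of j] by (simp add: a_def iter_def)
  have "(\<Sum>i\<in>UNIV. weight i * ?C n (branch i -` B \<inter> {0..M})) = (\<Sum>j<n. a (Suc j)) / real n" for n
    unfolding step[symmetric] using branch_vimage_sets[OF B]
    by (simp add: set_integral_cesaro sum_divide_distrib sum_distrib_left UNIV_bool sum.distrib add_divide_distrib)
  moreover have "(\<Sum>j<n. a (Suc j)) = (\<Sum>j<n. a j) + (a n - a 0)" for n
    by (induction n) auto
  ultimately have eq: "(\<Sum>i\<in>UNIV. weight i * ?C n (branch i -` B \<inter> {0..M})) = ?C n B + (a n - a 0) / real n" for n
    using B by (simp add: set_integral_cesaro a_def add_divide_distrib)
  have "(\<lambda>n. (a n - a 0) / real n) \<longlonglongrightarrow> 0"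
  proof (rule Lim_null_comparison)
    have "norm ((a n - a 0) / real n) \<le> 2 / real n" for n
      using a[of n] a[of 0] by (auto intro!: divide_right_mono)
    then show "eventually (\<lambda>n. norm ((a n - a 0) / real n) \<le> 2 / real n) sequentially" by simp
    show "(\<lambda>n. 2 / real n) \<longlonglongrightarrow> 0" by real_asymp
  qed
  then have "(\<lambda>n. ?C n B + (a n - a 0) / real n) \<longlonglongrightarrow> (LINT x:B|lambda \<beta>. g x) + 0"
    by (intro tendsto_add cesaro_limit B)
  moreover have "(\<lambda>n. \<Sum>i\<in>UNIV. weight i * ?C n (branch i -` B \<inter> {0..M})) \<longlonglongrightarrow>
      (\<Sum>i\<in>UNIV. weight i * (LINT x:(branch i -` B \<inter> {0..M})|lambda \<beta>. g x))"
    by (intro tendsto_sum tendsto_mult tendsto_const cesaro_limit branch_vimage_sets B)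
  ultimately show ?thesis unfolding eq using LIMSEQ_unique by fastforce
qed

lemma g_nonneg: "AE x in lambda \<beta>. 0 \<le> g x"
proof (rule lam.density_nonneg[OF integrable_g])
  fix E assume E: "E \<in> sets (lambda \<beta>)"
  have "0 \<le> (LINT x:E|lambda \<beta>. cesaro \<beta> p n x)" for n
    unfolding set_integral_cesaro[OF E] using set_integral_iter_bounds[OF E]
    by (intro divide_nonneg_nonneg sum_nonneg) auto
  then show "0 \<le> (LINT x:E|lambda \<beta>. g x)"
    by (intro LIMSEQ_le_const[OF cesaro_limit[OF E]]) auto
qed

lemma g_total: "(LINT x:{0..M}|lambda \<beta>. g x) = 1"
proof -
  have S: "{0..M} \<in> sets (lambda \<beta>)" using sets.top[of "lambda \<beta>"] by simp
  \<comment> \<open>The empty average is 0, so the identity holds from \<open>n = 1\<close>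
    on.\<close>
  have "(LINT x:{0..M}|lambda \<beta>. cesaro \<beta> p n x) = 1" if "n > 0" for n
    using that iter_spec unfolding set_integral_cesaro[OF S] by simp
  then have "(\<lambda>n. LINT x:{0..M}|lambda \<beta>. cesaro \<beta> p n x) \<longlonglongrightarrow> 1"
    by (intro tendsto_eventually eventually_sequentiallyI[of 1]) auto
  then show ?thesis using LIMSEQ_unique[OF cesaro_limit[OF S]] by simp
qed

end

section \<open>Expansion of intervals\<close>

context random_beta
begin

text \<open>The interval is open because at its endpoints the map may already follow a neighbouring
  branch; greedy and lazy cells are half-open on opposite sides.\<close>

definition straight :: "bool \<Rightarrow> real \<Rightarrow> real \<Rightarrow> int \<Rightarrow> bool" where
  "straight i a b d \<longleftrightarrow> 0 \<le> a \<and> a < b \<and> b \<le> M \<and> (\<forall>x\<in>{a<..<b}. branch i x = \<beta> * x - of_int d)"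

text \<open>The endpoints are approached from inside, where the values of the map lie in
  \<open>{0..M}\<close>.\<close>

lemma straight_image_range:
  assumes "straight i a b d"
  shows "0 \<le> \<beta> * a - of_int d" "\<beta> * b - of_int d \<le> M"
proof -
  have ab: "0 \<le> a" "a < b" "b \<le> M" and br: "\<And>x. x \<in> {a<..<b} \<Longrightarrow> branch i x = \<beta> * x - of_int d"
    using assms by (auto simp: straight_def)
  have in_M: "\<beta> * x - of_int d \<in> {0..M}" if "x \<in> {a<..<b}" for x
    using br[OF that] branch_range[of x i] that ab by auto
  have "((\<lambda>x. \<beta> * x - of_int d) \<longlongrightarrow> \<beta> * a - of_int d) (at_right a)"
    by (intro tendsto_intros)
  moreover have "eventually (\<lambda>x. 0 \<le> \<beta> * x - of_int d) (at_right a)"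
    using eventually_at_right_real[OF ab(2)] by eventually_elim (use in_M in auto)
  ultimately show "0 \<le> \<beta> * a - of_int d"
    by (intro tendsto_lowerbound[of _ _ "at_right a"]) auto
  have "((\<lambda>x. \<beta> * x - of_int d) \<longlongrightarrow> \<beta> * b - of_int d) (at_left b)"
    by (intro tendsto_intros)
  moreover have "eventually (\<lambda>x. \<beta> * x - of_int d \<le> M) (at_left b)"
    using eventually_at_left_real[OF ab(2)] by eventually_elim (use in_M in auto)
  ultimately show "\<beta> * b - of_int d \<le> M"
    by (intro tendsto_upperbound[of _ _ "at_left b"]) auto
qed

text \<open>The points \<open>of_int j / \<beta>\<close> with \<open>j\<close> from 1 to
  \<open>k\<close> are the discontinuities of the greedy map; between consecutive ones the capped
  floor is constant.\<close>

lemma straight_greedy: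
  assumes "0 \<le> a" "a < b" "b \<le> M" and no: "\<And>j. j \<in> {1..k} \<Longrightarrow> \<not> (a < of_int j / \<beta> \<and> of_int j / \<beta> < b)"
  shows "straight True a b (digit a)"
  unfolding straight_def
proof (intro conjI ballI)
  fix x assume x: "x \<in> {a<..<b}"
  have b0: "\<beta> > 0" using beta_gt_1 by simp
  have le: "\<beta> * a \<le> \<beta> * x" using x b0 by simp
  have "digit x = digit a"
  proof (cases "k \<le> \<lfloor>\<beta> * a\<rfloor>")
    case True
    then show ?thesis using floor_mono[OF le] by (simp add: digit_def)
  next
    case False
    \<comment> \<open>\<open>of_int j / \<beta>\<close> is the first greedy discontinuity to the
      right of \<open>a\<close>, so it cannot lie before \<open>b\<close>.\<close>
    define j where "j = \<lfloor>\<beta> * a\<rfloor> + 1"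
    have "j \<in> {1..k}" using False assms(1) b0 by (auto simp: j_def)
    moreover have "a < of_int j / \<beta>" using b0 by (simp add: j_def pos_less_divide_eq mult.commute)
    ultimately have "b \<le> of_int j / \<beta>" using no by force
    then have "x < of_int j / \<beta>" using x by simp
    then have "\<beta> * x < of_int j" using b0 by (simp add: pos_less_divide_eq mult.commute)
    then have "\<lfloor>\<beta> * x\<rfloor> < j" by (simp add: floor_less_iff)
    then have "\<lfloor>\<beta> * x\<rfloor> = \<lfloor>\<beta> * a\<rfloor>" using floor_mono[OF le] by (simp add: j_def)
    then show ?thesis by (simp add: digit_def)
  qed
  then show "branch True x = \<beta> * x - of_int (digit a)"
    using greedy_map_eq[of x] x assms by (simp add: branch_def)
qed (use assms in auto)

lemma straight_reflect:
  assumes "straight i a b d"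
  shows "straight (\<not> i) (M - b) (M - a) (k - d)"
  unfolding straight_def
proof (intro conjI ballI)
  fix x assume x: "x \<in> {M - b<..<M - a}"
  then have m: "M - x \<in> {a<..<b}" and xM: "x \<in> {0..M}" using assms by (auto simp: straight_def)
  have "branch (\<not> i) x = M - branch i (M - x)"
    using lazy_map_conj[OF xM] lazy_map_conj[of "M - x"] xM by (auto simp: branch_def)
  also have "\<dots> = \<beta> * x - of_int (k - d)"
  proof -
    have "branch i (M - x) = \<beta> * (M - x) - of_int d" using assms m unfolding straight_def by blast
    then show ?thesis using M_mult by (simp add: algebra_simps)
  qed
  finally show "branch (\<not> i) x = \<beta> * x - of_int (k - d)" .
qed (use assms in \<open>auto simp: straight_def\<close>)

text \<open>At a discontinuity the greedy map restarts from 0, as \<open>\<beta> * c = j\<close>.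
  The cell that begins at \<open>c\<close> has length \<open>1 / \<beta>\<close> for
  \<open>j < k\<close> and the larger length \<open>M / \<beta>\<close> for
  \<open>j = k\<close>.\<close>

lemma straight_greedy_at_discontinuity:
  assumes "j \<in> {1..k}" and c: "c = of_int j / \<beta>" and "c < b" "b \<le> c + 1 / \<beta>" "b \<le> M"
  shows "straight True c b j"
proof -
  have b0: "\<beta> > 0" using beta_gt_1 by simp
  have "\<beta> * c = of_int j" using b0 by (simp add: c)
  then have dc: "digit c = j" using assms(1) by (simp add: digit_def)
  have "straight True c b (digit c)"
  proof (rule straight_greedy)
    show "0 \<le> c" using assms(1) b0 by (simp add: c)
    fix j' assume "j' \<in> {1..k}"
    show "\<not> (c < of_int j' / \<beta> \<and> of_int j' / \<beta> < b)"
    proof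
      assume *: "c < of_int j' / \<beta> \<and> of_int j' / \<beta> < b"
      then have "j < j'" using b0 by (simp add: c divide_less_cancel)
      have "of_int j' / \<beta> < (of_int j + 1) / \<beta>" using * assms(4) c by (simp add: add_divide_distrib)
      then have "real_of_int j' < of_int j + 1" using b0 by (simp add: divide_less_cancel)
      with \<open>j < j'\<close> show False by linarith
    qed
  qed (use assms in auto)
  then show ?thesis by (simp add: dc)
qed

text \<open>The lazy cell with digit 0 is the reflected last greedy cell and reaches up to
  \<open>M / \<beta>\<close>; multiplication by \<beta> maps it onto \<open>{0..M}\<close>.\<close>

lemma straight_lazy_at_zero:
  assumes "0 < e" "e \<le> M / \<beta>"
  shows "straight False 0 e 0"
proof -
  have b0: "\<beta> > 0" using beta_gt_1 by simp
  have M0: "M / \<beta> \<le> M" using M_gt_1 beta_gt_1 by (simp add: field_simps)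
  have "\<beta> * (M - e) \<ge> of_int k" using assms b0 M_mult by (simp add: field_simps)
  then have d: "digit (M - e) = k" by (simp add: digit_def le_floor_iff)
  have "straight True (M - e) M (digit (M - e))"
  proof (rule straight_greedy)
    fix j assume "j \<in> {1..k}"
    then have "of_int j / \<beta> \<le> of_int k / \<beta>" using b0 by (simp add: divide_right_mono)
    also have "\<dots> \<le> M - e" using \<open>\<beta> * (M - e) \<ge> of_int k\<close> b0 by (simp add: field_simps)
    finally show "\<not> (M - e < of_int j / \<beta> \<and> of_int j / \<beta> < M)" by simp
  qed (use assms M0 in auto)
  from straight_reflect[OF this] d show ?thesis by simp
qed

lemma straight_image_measure:
  assumes s: "straight i a b d" and S: "S \<in> sets borel" "S \<subseteq> {\<beta> * a - of_int d<..<\<beta> * b - of_int d}"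
  shows "measure lborel S = \<beta> * measure lborel (branch i -` S \<inter> {a<..<b})"
proof -
  have b0: "\<beta> > 0" using beta_gt_1 by simp
  have "(\<lambda>x. \<beta> * x - of_int d) -` S = branch i -` S \<inter> {a<..<b}"
  proof (intro equalityI subsetI)
    fix x assume x: "x \<in> (\<lambda>x. \<beta> * x - of_int d) -` S"
    then have "\<beta> * a < \<beta> * x" "\<beta> * x < \<beta> * b" using S(2) by auto
    then have "x \<in> {a<..<b}" using b0 by simp
    with x s show "x \<in> branch i -` S \<inter> {a<..<b}" by (auto simp: straight_def)
  qed (use s in \<open>auto simp: straight_def\<close>)
  then show ?thesis
    using emeasure_lborel_vimage_affine[OF S(1) b0, of "of_int d"] b0
    by (simp add: measure_def enn2real_mult)
qed

text \<open>An interval at 0 grows by the factor \<beta> under the lazy branch with digit 0 until it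
  reaches the end of that cell. Nothing is cut off on the way, so \<open>P\<close> need not pass to
  subintervals, and the lemma also serves for densities.\<close>

lemma expand_left_corner:
  assumes step: "\<And>i a b d. straight i a b d \<Longrightarrow> P a b \<Longrightarrow> P (\<beta> * a - of_int d) (\<beta> * b - of_int d)"
    and P: "P 0 e" "0 < e" "e \<le> M"
  shows "\<exists>e'. M / \<beta> \<le> e' \<and> e' \<le> M \<and> P 0 e'"
proof (rule ccontr)
  assume none: "\<not> ?thesis"
  have "\<exists>e'. e' \<le> M \<and> P 0 e' \<and> \<beta> ^ n * e \<le> e'" for n
  proof (induction n)
    case 0
    then show ?case using P by auto
  next
    case (Suc n)
    then obtain e' where e': "e' \<le> M" "P 0 e'" "\<beta> ^ n * e \<le> e'" by blast
    have pos: "0 < \<beta> ^ n * e" using P beta_gt_1 by simp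
    have s: "straight False 0 e' 0"
      using none e' pos by (intro straight_lazy_at_zero) force+
    have "\<beta> ^ Suc n * e \<le> \<beta> * e'" using e'(3) beta_gt_1 by simp
    with step[OF s e'(2)] straight_image_range[OF s] show ?case by auto
  qed
  moreover obtain n where "M / e < \<beta> ^ n" using real_arch_pow[OF beta_gt_1] by blast
  then have "M < \<beta> ^ n * e" using P by (simp add: field_simps)
  ultimately show False by (meson le_less_trans not_le)
qed

lemma expand_from_zero:
  assumes H: "\<And>a b a' b'. P a b \<Longrightarrow> a \<le> a' \<Longrightarrow> a' < b' \<Longrightarrow> b' \<le> b \<Longrightarrow> P a' b'"
    and step: "\<And>i a b d. straight i a b d \<Longrightarrow> P a b \<Longrightarrow> P (\<beta> * a - of_int d) (\<beta> * b - of_int d)"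
    and P: "P 0 e" "0 < e" "e \<le> M"
  shows "P 0 M"
proof -
  have M0: "0 < M / \<beta>" using M_gt_1 beta_gt_1 by simp
  have "\<exists>e'. M / \<beta> \<le> e' \<and> e' \<le> M \<and> P 0 e'"
    using step P by (intro expand_left_corner[where P = P and e = e]) blast+
  then obtain e' where e': "M / \<beta> \<le> e'" "P 0 e'" by blast
  \<comment> \<open>Trimming to the exact cell makes its image end at \<open>M\<close>.\<close>
  have "P 0 (M / \<beta>)" using M0 e' by (intro H[OF e'(2)]) auto
  from step[OF straight_lazy_at_zero[OF M0 order_refl] this] show ?thesis using beta_gt_1 by simp
qed

lemma expand_to_all:
  assumes H: "\<And>a b a' b'. P a b \<Longrightarrow> a \<le> a' \<Longrightarrow> a' < b' \<Longrightarrow> b' \<le> b \<Longrightarrow> P a' b'"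
    and step: "\<And>i a b d. straight i a b d \<Longrightarrow> P a b \<Longrightarrow> P (\<beta> * a - of_int d) (\<beta> * b - of_int d)"
    and P: "P a b" "0 \<le> a" "a < b" "b \<le> M"
  shows "P 0 M"
proof (rule ccontr)
  assume contra: "\<not> P 0 M"
  have b0: "\<beta> > 0" using beta_gt_1 by simp
  have "\<exists>u v. 0 \<le> u \<and> v \<le> M \<and> P u v \<and> \<beta> ^ n * (b - a) \<le> v - u" for n
  proof (induction n)
    case 0
    then show ?case using P by auto
  next
    case (Suc n)
    then obtain u v where uv: "0 \<le> u" "v \<le> M" "P u v" "\<beta> ^ n * (b - a) \<le> v - u" by blast
    have "0 < \<beta> ^ n * (b - a)" using P b0 by simp
    then have "u < v" using uv by simp
    show ?case
    proof (cases "\<exists>j\<in>{1..k}. u < of_int j / \<beta> \<and> of_int j / \<beta> < v")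
      case True
      then obtain j where j: "j \<in> {1..k}" "u < of_int j / \<beta>" "of_int j / \<beta> < v" by blast
      define c where "c = of_int j / \<beta>"
      \<comment> \<open>Heredity allows keeping only the part from the discontinuity
        \<open>c\<close> to \<open>w\<close>, cut off at \<open>c + 1 / \<beta>\<close> so that it
        stays in one greedy cell; its image begins at 0.\<close>
      define w where "w = min v (c + 1 / \<beta>)"
      have cw: "c < w" using j b0 by (simp add: c_def w_def)
      have s: "straight True c w j"
        using cw uv by (intro straight_greedy_at_discontinuity j c_def) (auto simp: w_def)
      have "P c w" using cw j by (intro H[OF uv(3)]) (auto simp: c_def w_def)
      from step[OF s this] have "P 0 (\<beta> * w - of_int j)" using b0 by (simp add: c_def)
      moreover have "0 < \<beta> * w - of_int j" using cw b0 by (simp add: c_def pos_divide_less_eq mult.commute)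
      ultimately have "P 0 M" using straight_image_range(2)[OF s] by (intro expand_from_zero[where P = P, OF H step])
      with contra show ?thesis by simp
    next
      case False
      then have s: "straight True u v (digit u)"
        using uv \<open>u < v\<close> by (intro straight_greedy) auto
      have "\<beta> ^ Suc n * (b - a) \<le> (\<beta> * v - of_int (digit u)) - (\<beta> * u - of_int (digit u))"
        using mult_left_mono[OF uv(4), of \<beta>] b0 by (simp add: algebra_simps)
      then show ?thesis using step[OF s uv(3)] straight_image_range[OF s] by blast
    qed
  qed
  then have "\<beta> ^ n * (b - a) \<le> M" for n
    by (smt (verit))
  moreover obtain n where "M / (b - a) < \<beta> ^ n" using real_arch_pow[OF beta_gt_1] by blast
  then have "M < \<beta> ^ n * (b - a)" using P by (simp add: field_simps)
  ultimately show False by (meson not_le)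
qed

lemma measure_lambda:
  assumes "B \<in> sets (lambda \<beta>)"
  shows "measure (lambda \<beta>) B = measure lborel B / M"
proof -
  have "B \<subseteq> {0..M}" using assms by (simp add: sets_lambda_iff)
  then have "emeasure lborel B \<le> emeasure lborel {0..M}" by (intro emeasure_mono) auto
  then have "emeasure lborel B \<noteq> top" using M_gt_1 by (auto simp: top_unique)
  then have "emeasure lborel B = ennreal (measure lborel B)" by (rule emeasure_eq_ennreal_measure)
  then have "emeasure (lambda \<beta>) B = ennreal (measure lborel B / M)"
    using assms M_gt_1 by (simp add: emeasure_lambda divide_ennreal)
  then show ?thesis using M_gt_1 by (simp add: measure_def)
qed

lemma AE_lambda_witness:
  assumes "AE x in lambda \<beta>. Q x" "0 \<le> a" "a < b" "b \<le> M"
  shows "\<exists>x\<in>{a<..<b}. Q x"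
proof (rule ccontr)
  assume none: "\<not> ?thesis"
  obtain N where N: "N \<in> null_sets (lambda \<beta>)" "{x \<in> {0..M}. \<not> Q x} \<subseteq> N"
    using assms(1) by (auto simp: eventually_ae_filter)
  have "{a<..<b} \<subseteq> N" using N(2) none assms by auto
  moreover have "N \<in> null_sets lborel" using N(1) by (simp add: null_sets_lambda_iff)
  ultimately have "{a<..<b} \<in> null_sets lborel" using null_sets_subset[of N lborel "{a<..<b}"] by simp
  then have "emeasure lborel {a<..<b} = 0" by (rule null_setsD1)
  then show False using assms by simp
qed

end

section \<open>The lower bound for the density\<close>

context limit_density
begin

lemma set_integral_lambda_mono_set:
  assumes "A \<in> sets (lambda \<beta>)" "B \<in> sets (lambda \<beta>)" "A \<subseteq> B"
  shows "(LINT x:A|lambda \<beta>. g x) \<le> (LINT x:B|lambda \<beta>. g x)"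
  unfolding set_lebesgue_integral_def using g_nonneg assms integrable_g
  by (intro integral_mono_AE integrable_mult_indicator) (auto simp: indicator_def)

lemma set_integral_ge_of_AE:
  assumes c: "AE x in lambda \<beta>. x \<in> {a<..<b} \<longrightarrow> c \<le> g x" and S: "S \<in> sets (lambda \<beta>)" "S \<subseteq> {a<..<b}"
  shows "c * measure (lambda \<beta>) S \<le> (LINT x:S|lambda \<beta>. g x)"
proof -
  have "c * measure (lambda \<beta>) S = (LINT x:S|lambda \<beta>. c)"
    using S sets.sets_into_space[OF S(1)] by (simp add: set_lebesgue_integral_def Int_absorb2)
  also have "\<dots> \<le> (LINT x:S|lambda \<beta>. g x)"
    unfolding set_lebesgue_integral_def
  proof (intro integral_mono_AE integrable_mult_indicator)
    show "AE x in lambda \<beta>. indicator S x *\<^sub>R c \<le> indicator S x *\<^sub>R g x"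
      using c by eventually_elim (use S(2) in \<open>auto simp: indicator_def\<close>)
  qed (use S integrable_g in auto)
  finally show ?thesis .
qed

text \<open>By stationarity a set \<open>S\<close> in the image receives at least
  \<open>weight i\<close> times the mass of its preimage in \<open>{a<..<b}\<close>, whose Lebesgue
  measure is that of \<open>S\<close> divided by \<beta>. All other contributions are nonnegative
  and dropped.\<close>

lemma lower_bound_straight:
  assumes s: "straight i a b d" and c: "AE x in lambda \<beta>. x \<in> {a<..<b} \<longrightarrow> c \<le> g x"
  shows "AE x in lambda \<beta>. x \<in> {\<beta> * a - of_int d<..<\<beta> * b - of_int d} \<longrightarrow> weight i * c / \<beta> \<le> g x"
proof -
  define I where "I = {\<beta> * a - of_int d<..<\<beta> * b - of_int d}"
  let ?c = "weight i * c / \<beta>"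
  \<comment> \<open>Cutting off outside the image turns the claim on \<open>I\<close> into
    nonnegativity almost everywhere, which can be tested on sets.\<close>
  let ?f = "\<lambda>x. indicator I x *\<^sub>R (g x - ?c)"
  have I: "I \<in> sets (lambda \<beta>)"
    using straight_image_range[OF s] by (auto simp: I_def sets_lambda_iff)
  have int: "integrable (lambda \<beta>) ?f"
    using integrable_g I by (intro integrable_mult_indicator) auto
  have "AE x in lambda \<beta>. 0 \<le> ?f x"
  proof (rule lam.density_nonneg[OF int])
    fix E assume E: "E \<in> sets (lambda \<beta>)"
    define S where "S = E \<inter> I"
    have S: "S \<in> sets (lambda \<beta>)" "S \<subseteq> I" using E I by (auto simp: S_def)
    have S': "S \<in> sets borel" "S \<subseteq> {\<beta> * a - of_int d<..<\<beta> * b - of_int d}" using S by (auto simp: sets_lambda_iff I_def)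
    define S1 where "S1 = branch i -` S \<inter> {a<..<b}"
    have "S1 = (branch i -` S \<inter> {0..M}) \<inter> {a<..<b}" using s by (auto simp: S1_def straight_def)
    moreover have "{a<..<b} \<in> sets (lambda \<beta>)" using s by (auto simp: sets_lambda_iff straight_def)
    ultimately have S1: "S1 \<in> sets (lambda \<beta>)" using branch_vimage_sets[OF S(1), of i] by simp
    have "?c * measure (lambda \<beta>) S = weight i * (c * measure (lambda \<beta>) S1)"
      using straight_image_measure[OF s S'] beta_gt_1 S S1 by (simp add: measure_lambda S1_def)
    also have "\<dots> \<le> weight i * (LINT x:S1|lambda \<beta>. g x)"
      using weight_pos[of i] S1 by (intro mult_left_mono set_integral_ge_of_AE[OF c]) (auto simp: S1_def)
    also have "\<dots> \<le> weight i * (LINT x:(branch i -` S \<inter> {0..M})|lambda \<beta>. g x)"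
      using weight_pos[of i] S1 branch_vimage_sets[OF S(1), of i] s
      by (intro mult_left_mono set_integral_lambda_mono_set) (auto simp: S1_def straight_def)
    also have "\<dots> \<le> (\<Sum>i\<in>UNIV. weight i * (LINT x:(branch i -` S \<inter> {0..M})|lambda \<beta>. g x))"
    proof (rule member_le_sum)
      fix j show "0 \<le> weight j * (LINT x:(branch j -` S \<inter> {0..M})|lambda \<beta>. g x)"
        unfolding set_lebesgue_integral_def using weight_pos[of j] g_nonneg
        by (intro mult_nonneg_nonneg integral_nonneg_AE) auto
    qed auto
    also have "\<dots> = (LINT x:S|lambda \<beta>. g x)" by (rule g_stationary[OF S(1)])
    finally have "0 \<le> (LINT x:S|lambda \<beta>. g x) - ?c * measure (lambda \<beta>) S" by simp
    also have "\<dots> = (LINT x:S|lambda \<beta>. g x - ?c)"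
      using set_integrable_of_integrable[OF integrable_g S(1)] set_integrable_of_integrable[OF _ S(1), of "\<lambda>_. ?c"] S
        sets.sets_into_space[OF S(1)]
      by (subst set_integral_diff(2)) (auto simp: set_lebesgue_integral_def Int_absorb2)
    also have "\<dots> = (LINT x:E|lambda \<beta>. ?f x)"
      unfolding set_lebesgue_integral_def S_def by (intro Bochner_Integration.integral_cong) (auto simp: indicator_def)
    finally show "0 \<le> (LINT x:E|lambda \<beta>. ?f x)" .
  qed
  then show ?thesis by eventually_elim (auto simp: I_def indicator_def)
qed

text \<open>The total mass is 1, so \<open>g\<close> is positive on a non-null set; its
  discontinuities are countably many, so some positive value is attained at a point of
  continuity.\<close>

lemma ex_interval_lower_bound:
  "\<exists>a b c. 0 \<le> a \<and> a < b \<and> b \<le> M \<and> 0 < c \<and> (\<forall>x\<in>{a<..<b}. c \<le> g x)"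
proof -
  let ?D = "{x \<in> {0<..<M}. \<not> isCont g x} \<union> {0, M}"
  have "countable ?D" using bounded_variation_on_countable_discontinuities[OF bv] by auto
  then have "?D \<in> null_sets lborel" by (rule countable_imp_null_set_lborel)
  then have "?D \<in> null_sets (lambda \<beta>)" using M_gt_1 by (auto simp: null_sets_lambda_iff)
  then have D: "AE x in lambda \<beta>. x \<notin> ?D" by (rule AE_not_in)
  have "\<exists>x\<in>{0..M}. x \<notin> ?D \<and> 0 < g x"
  proof (rule ccontr)
    assume none: "\<not> ?thesis"
    have "AE x in lambda \<beta>. g x \<le> 0" using D AE_space[of "lambda \<beta>"]
      by eventually_elim (use none in force)
    then have "(LINT x:{0..M}|lambda \<beta>. g x) \<le> (\<integral>x. 0 \<partial>lambda \<beta>)"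
      unfolding set_lebesgue_integral_def using integrable_g sets.top[of "lambda \<beta>"]
      by (intro integral_mono_AE integrable_mult_indicator) (auto simp: indicator_def)
    then show False using g_total by simp
  qed
  then obtain x where x: "x \<in> {0<..<M}" "isCont g x" "0 < g x" by force
  then have "eventually (\<lambda>y. g x / 2 < g y) (nhds x)"
    using order_tendstoD(1)[of g "g x" "nhds x" "g x / 2"] by (simp add: isCont_def tendsto_at_iff_tendsto_nhds)
  then obtain e where e: "e > 0" "\<And>y. dist y x < e \<Longrightarrow> g x / 2 < g y"
    by (auto simp: eventually_nhds_metric)
  define a where "a = max 0 (x - e)" define b where "b = min M (x + e)"
  show ?thesis
  proof (intro exI conjI ballI)
    show "0 \<le> a" "a < b" "b \<le> M" using x e by (auto simp: a_def b_def)
    show "0 < g x / 2" using x by simp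
    fix y assume "y \<in> {a<..<b}"
    then have "dist y x < e" by (auto simp: a_def b_def dist_real_def)
    then show "g x / 2 \<le> g y" using e(2) by (simp add: less_imp_le)
  qed
qed

lemma g_lower_bound: "\<exists>c>0. AE x in lambda \<beta>. c \<le> g x"
proof -
  \<comment> \<open>The constant is quantified inside \<open>P\<close> since each branch step
    multiplies it by \<open>weight i / \<beta>\<close>; finitely many steps leave it
    positive.\<close>
  define P where "P a b \<longleftrightarrow> (\<exists>c>0. AE x in lambda \<beta>. x \<in> {a<..<b} \<longrightarrow> c \<le> g x)" for a b
  obtain a b c where abc: "0 \<le> a" "a < b" "b \<le> M" "0 < c" "\<forall>x\<in>{a<..<b}. c \<le> g x"
    using ex_interval_lower_bound by blast
  have "P 0 M"
  proof (rule expand_to_all)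
    show "P a b" using abc by (auto simp: P_def intro!: exI[of _ c])
    fix a b a' b' assume "P a b" and le: "a \<le> a'" "b' \<le> b"
    then obtain c where c: "c > 0" "AE x in lambda \<beta>. x \<in> {a<..<b} \<longrightarrow> c \<le> g x" by (auto simp: P_def)
    from c(2) have "AE x in lambda \<beta>. x \<in> {a'<..<b'} \<longrightarrow> c \<le> g x"
      by eventually_elim (use le in auto)
    with c(1) show "P a' b'" by (auto simp: P_def)
  next
    fix i a b d assume s: "straight i a b d" and "P a b"
    then obtain c where c: "c > 0" "AE x in lambda \<beta>. x \<in> {a<..<b} \<longrightarrow> c \<le> g x" by (auto simp: P_def)
    have "weight i * c / \<beta> > 0" using c(1) weight_pos[of i] beta_gt_1 by simp
    with lower_bound_straight[OF s c(2)] show "P (\<beta> * a - of_int d) (\<beta> * b - of_int d)"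
      unfolding P_def by blast
  qed (use abc in auto)
  then obtain c where c: "c > 0" "AE x in lambda \<beta>. x \<in> {0<..<M} \<longrightarrow> c \<le> g x" by (auto simp: P_def)
  have "{0, M} \<in> null_sets lborel" by (rule countable_imp_null_set_lborel) auto
  then have "{0, M} \<in> null_sets (lambda \<beta>)" using M_gt_1 by (auto simp: null_sets_lambda_iff)
  from AE_not_in[OF this] c(2) AE_space[of "lambda \<beta>"] have "AE x in lambda \<beta>. c \<le> g x"
    by eventually_elim auto
  with c(1) show ?thesis by blast
qed

section \<open>The lower semicontinuous version of the density\<close>

abbreviation "h \<equiv> one_star \<beta> g"

lemma h_eq_lsc_version: "h = lsc_version 0 M g"
  by (simp add: one_star_def[abs_def] M_def)

lemma at_right_limit_ge:
  assumes "AE x in lambda \<beta>. c \<le> g x" "(g \<longlongrightarrow> l) (at_right x)" "0 \<le> x" "x < M"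
  shows "c \<le> l"
proof (rule ccontr)
  assume "\<not> c \<le> l"
  then have "eventually (\<lambda>y. g y < c) (at_right x)" using order_tendstoD(2)[OF assms(2)] by auto
  then obtain b where b: "b > x" "\<And>y. y > x \<Longrightarrow> y < b \<Longrightarrow> g y < c"
    unfolding eventually_at_right_field by blast
  obtain y where "y \<in> {x<..<min b M}" "c \<le> g y"
    using AE_lambda_witness[OF assms(1), of x "min b M"] b assms by auto
  then show False using b(2)[of y] by auto
qed

lemma at_left_limit_ge:
  assumes "AE x in lambda \<beta>. c \<le> g x" "(g \<longlongrightarrow> l) (at_left x)" "0 < x" "x \<le> M"
  shows "c \<le> l"
proof (rule ccontr)
  assume "\<not> c \<le> l"
  then have "eventually (\<lambda>y. g y < c) (at_left x)" using order_tendstoD(2)[OF assms(2)] by auto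
  then obtain b where b: "b < x" "\<And>y. y > b \<Longrightarrow> y < x \<Longrightarrow> g y < c"
    unfolding eventually_at_left_field by blast
  obtain y where "y \<in> {max b 0<..<x}" "c \<le> g y"
    using AE_lambda_witness[OF assms(1), of "max b 0" x] b assms by auto
  then show False using b(2)[of y] by auto
qed

text \<open>On \<open>{0..M}\<close> every value of \<open>h\<close> is a one-sided limit of
  \<open>g\<close> or the smaller of two. A bound that holds almost everywhere passes to such limits
  because it holds somewhere in every interval. Bounded variation guarantees that the limits exist,
  so that \<open>Lim\<close> is meaningful.\<close>

lemma h_lower_bound:
  assumes c: "AE x in lambda \<beta>. c \<le> g x" and x: "x \<in> {0..M}"
  shows "c \<le> h x"
proof -
  have R: "c \<le> Lim (at_right x) g" if "0 \<le> x" "x < M" for x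
  proof -
    obtain l where l: "(g \<longlongrightarrow> l) (at_right x)"
      using bounded_variation_on_at_right_limit[OF bv \<open>0 \<le> x\<close> \<open>x < M\<close>] by blast
    then have "Lim (at_right x) g = l" by (intro tendsto_Lim) auto
    then show ?thesis using at_right_limit_ge[OF c l \<open>0 \<le> x\<close> \<open>x < M\<close>] by simp
  qed
  have L: "c \<le> Lim (at_left x) g" if "0 < x" "x \<le> M" for x
  proof -
    obtain l where l: "(g \<longlongrightarrow> l) (at_left x)"
      using bounded_variation_on_at_left_limit[OF bv \<open>0 < x\<close> \<open>x \<le> M\<close>] by blast
    then have "Lim (at_left x) g = l" by (intro tendsto_Lim) auto
    then show ?thesis using at_left_limit_ge[OF c l \<open>0 < x\<close> \<open>x \<le> M\<close>] by simp
  qed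
  have C: "c \<le> g x" if "isCont g x" "x \<in> {0<..<M}"
    by (rule at_right_limit_ge[OF c, of _ x])
      (use that in \<open>auto simp: isCont_def intro: filterlim_at_split[THEN iffD1, THEN conjunct2]\<close>)
  show ?thesis
    using x M_gt_1 R[of 0] L[of M] R[of x] L[of x] C by (auto simp: h_eq_lsc_version lsc_version_def)
qed

lemma countable_h_neq_g: "countable {x \<in> {0..M}. h x \<noteq> g x}"
proof (rule countable_subset)
  show "{x \<in> {0..M}. h x \<noteq> g x} \<subseteq> {x \<in> {0<..<M}. \<not> isCont g x} \<union> {0, M}"
    by (auto simp: h_eq_lsc_version lsc_version_def split: if_splits)
  show "countable ({x \<in> {0<..<M}. \<not> isCont g x} \<union> {0, M})"
    using bounded_variation_on_countable_discontinuities[OF bv] by auto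
qed

lemma h_measurable: "h \<in> borel_measurable (lambda \<beta>)"
proof (rule measurable_discrete_difference[OF _ countable_h_neq_g])
  show "g \<in> borel_measurable (lambda \<beta>)" using integrable_g by auto
qed (auto simp: sets_lambda_iff)

lemma h_AE_eq: "AE x in lambda \<beta>. h x = g x"
proof -
  have "{x \<in> {0..M}. h x \<noteq> g x} \<in> null_sets (lambda \<beta>)"
    using countable_imp_null_set_lborel[OF countable_h_neq_g] by (auto simp: null_sets_lambda_iff)
  then show ?thesis by (rule AE_I') auto
qed

lemma h_bounded_below: "\<exists>d>0. \<forall>x\<in>{0..M}. d \<le> h x"
  using g_lower_bound h_lower_bound by blast

section \<open>The stationary measure \<mu>\<close>

definition "\<mu> = mu_density \<beta> h"

lemma sets_mu [measurable_cong, simp]: "sets \<mu> = sets (lambda \<beta>)"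
  and space_mu [simp]: "space \<mu> = {0..M}"
  by (simp_all add: \<mu>_def mu_density_def)

lemma emeasure_mu:
  assumes "B \<in> sets (lambda \<beta>)"
  shows "emeasure \<mu> B = ennreal (LINT x:B|lambda \<beta>. g x)"
proof -
  have "emeasure \<mu> B = (\<integral>\<^sup>+x. ennreal (h x) * indicator B x \<partial>lambda \<beta>)"
    unfolding \<mu>_def mu_density_def using h_measurable assms by (subst emeasure_density) auto
  also have "\<dots> = (\<integral>\<^sup>+x. ennreal (indicator B x *\<^sub>R g x) \<partial>lambda \<beta>)"
    using h_AE_eq by (intro nn_integral_cong_AE) (auto simp: indicator_def)
  also have "\<dots> = ennreal (LINT x:B|lambda \<beta>. g x)"
    unfolding set_lebesgue_integral_def using g_nonneg
    by (intro nn_integral_eq_integral integrable_mult_indicator assms integrable_g) (auto simp: indicator_def)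
  finally show ?thesis .
qed

lemma prob_space_mu: "prob_space \<mu>"
proof
  show "emeasure \<mu> (space \<mu>) = 1"
    using emeasure_mu[of "{0..M}"] g_total sets.top[of "lambda \<beta>"] by simp
qed

sublocale mu: prob_space \<mu> by (rule prob_space_mu)

lemma measurable_branch_mu: "branch i \<in> measurable \<mu> \<mu>"
  using measurable_branch by (subst measurable_cong_sets[OF sets_mu sets_mu])

lemma mu_stationary:
  assumes B: "B \<in> sets \<mu>"
  shows "emeasure \<mu> B = (\<Sum>i\<in>UNIV. ennreal (weight i) * emeasure \<mu> (branch i -` B \<inter> {0..M}))"
proof -
  have B': "B \<in> sets (lambda \<beta>)" using B by simp
  have nn: "0 \<le> (LINT x:C|lambda \<beta>. g x)" for C
    unfolding set_lebesgue_integral_def using g_nonneg by (intro integral_nonneg_AE) auto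
  show ?thesis
    using B' branch_vimage_sets[OF B'] weight_pos nn
    by (simp add: emeasure_mu g_stationary[symmetric] UNIV_bool ennreal_plus ennreal_mult less_imp_le)
qed

text \<open>The positive lower bound on the density gives \<mu> and \<open>lambda \<beta>\<close>
  the same null sets. Ergodicity needs this too: invariant functions are integrated against \<mu>,
  while the zero-one law is about Lebesgue measure.\<close>

lemma AE_mu_iff: "(AE x in \<mu>. Q x) \<longleftrightarrow> (AE x in lambda \<beta>. Q x)"
proof -
  obtain d where d: "d > 0" "\<And>x. x \<in> {0..M} \<Longrightarrow> d \<le> h x" using h_bounded_below by blast
  have "(AE x in \<mu>. Q x) \<longleftrightarrow> (AE x in lambda \<beta>. 0 < ennreal (h x) \<longrightarrow> Q x)"
    unfolding \<mu>_def mu_density_def using h_measurable by (subst AE_density) auto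
  also have "\<dots> \<longleftrightarrow> (AE x in lambda \<beta>. Q x)"
    using d by (intro AE_cong) force
  finally show ?thesis .
qed

end

section \<open>The zero-one law for sets invariant under both maps\<close>

lemma finite_positive_lower_bound:
  fixes A :: "real set"
  assumes "finite A"
  obtains e where "e > 0" "\<And>a. a \<in> A \<Longrightarrow> a > 0 \<Longrightarrow> e \<le> a"
\<comment> \<open>The element 1 keeps the set nonempty when \<open>A\<close> has no positive
  element.\<close>
proof (rule that[of "Min (insert 1 {a \<in> A. a > 0})"])
  have fin: "finite (insert 1 {a \<in> A. a > 0})" using assms by simp
  then show "0 < Min (insert 1 {a \<in> A. a > 0})" by (subst Min_gr_iff) auto
  show "Min (insert 1 {a \<in> A. a > 0}) \<le> a" if "a \<in> A" "a > 0" for a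
    using fin that by (intro Min_le) auto
qed

context random_beta
begin

lemma expand_right_corner:
  assumes step: "\<And>i a b d. straight i a b d \<Longrightarrow> P a b \<Longrightarrow> P (\<beta> * a - of_int d) (\<beta> * b - of_int d)"
    and P: "P (M - e) M" "0 < e" "e \<le> M"
  shows "\<exists>e'. M / \<beta> \<le> e' \<and> e' \<le> M \<and> P (M - e') M"
proof -
  have "\<exists>e'. M / \<beta> \<le> e' \<and> e' \<le> M \<and> P (M - e') (M - 0)"
  proof (rule expand_left_corner[where P = "\<lambda>a b. P (M - b) (M - a)"])
    fix i a b d assume s: "straight i a b d" and "P (M - b) (M - a)"
    from step[OF straight_reflect[OF this(1)] this(2)]
    show "P (M - (\<beta> * b - of_int d)) (M - (\<beta> * a - of_int d))"
      using M_mult by (simp add: algebra_simps)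
  qed (use P in auto)
  then show ?thesis by simp
qed

text \<open>An interval shorter than the distance between distinct discontinuities of the two maps either lies in
  a branch of one of them or is cut by a common discontinuity. After such a cut each half is sent to a corner
  of \<open>{0..M}\<close>, where no further cut occurs.\<close>

lemma expand_to_definite_length:
  obtains \<eta> where "\<eta> > 0"
    "\<And>P a b. (\<And>i a b d. straight i a b d \<Longrightarrow> P a b \<Longrightarrow> P (\<beta> * a - of_int d) (\<beta> * b - of_int d)) \<Longrightarrow>
      (\<And>a c b. 0 \<le> a \<Longrightarrow> b \<le> M \<Longrightarrow> a < c \<Longrightarrow> c < b \<Longrightarrow> P a b \<Longrightarrow> P a c \<or> P c b) \<Longrightarrow>
      0 \<le> a \<Longrightarrow> a < b \<Longrightarrow> b \<le> M \<Longrightarrow> P a b \<Longrightarrow>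
      \<exists>u v. 0 \<le> u \<and> v \<le> M \<and> \<eta> \<le> v - u \<and> P u v"
proof -
  have b0: "\<beta> > 0" using beta_gt_1 by simp
  define T where "T = (\<lambda>j. of_int j / \<beta>) ` {1..k}"
  define L where "L = (\<lambda>c. M - c) ` T"
  have fin: "finite ((\<lambda>(c, c'). \<bar>c - c'\<bar>) ` (T \<times> L))" by (simp add: T_def L_def)
  obtain e where e: "e > 0" "\<And>a. a \<in> (\<lambda>(c, c'). \<bar>c - c'\<bar>) ` (T \<times> L) \<Longrightarrow> a > 0 \<Longrightarrow> e \<le> a"
    using finite_positive_lower_bound[OF fin] by blast
  \<comment> \<open>Besides separating greedy from lazy discontinuities, \<eta> is at most
    \<open>1 / \<beta>\<close>, so that each piece beside a cut fits into one cell; then also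
    \<open>\<eta> \<le> M / \<beta>\<close>, so the corner intervals obtained in the end are long
    enough.\<close>
  define \<eta> where "\<eta> = min e (1 / \<beta>)"
  have \<eta>: "\<eta> > 0" "\<eta> \<le> 1 / \<beta>" using e b0 by (auto simp: \<eta>_def)
  have sep: "c = c'" if "c \<in> T" "c' \<in> L" "\<bar>c - c'\<bar> < \<eta>" for c c'
  proof (rule ccontr)
    assume "c \<noteq> c'"
    then have "e \<le> \<bar>c - c'\<bar>" using that by (intro e(2)) auto
    then show False using that(3) by (simp add: \<eta>_def)
  qed
  have "1 / \<beta> \<le> M / \<beta>" using M_gt_1 b0 by (simp add: divide_right_mono)
  then have \<eta>M: "\<eta> \<le> M / \<beta>" using \<eta>(2) by linarith
  show thesis
  proof (rule that[OF \<eta>(1)])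
    fix P and a b :: real
    assume step: "\<And>i a b d. straight i a b d \<Longrightarrow> P a b \<Longrightarrow> P (\<beta> * a - of_int d) (\<beta> * b - of_int d)"
      and split: "\<And>a c b. 0 \<le> a \<Longrightarrow> b \<le> M \<Longrightarrow> a < c \<Longrightarrow> c < b \<Longrightarrow> P a b \<Longrightarrow> P a c \<or> P c b"
      and ab: "0 \<le> a" "a < b" "b \<le> M" "P a b"
    show "\<exists>u v. 0 \<le> u \<and> v \<le> M \<and> \<eta> \<le> v - u \<and> P u v"
    proof (rule ccontr)
      assume none: "\<not> ?thesis"
      \<comment> \<open>While all intervals with \<open>P\<close> stay shorter than \<eta>, each
        step stretches by \<beta>, for a common cut would already yield the conclusion; such growth
        contradicts the length \<open>M\<close>.\<close>
      have "\<exists>u v. 0 \<le> u \<and> v \<le> M \<and> P u v \<and> \<beta> ^ n * (b - a) \<le> v - u" for n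
      proof (induction n)
        case 0
        then show ?case using ab by auto
      next
        case (Suc n)
        then obtain u v where uv: "0 \<le> u" "v \<le> M" "P u v" "\<beta> ^ n * (b - a) \<le> v - u" by blast
        have "0 < \<beta> ^ n * (b - a)" using ab b0 by simp
        then have "u < v" using uv by simp
        have short: "v - u < \<eta>" using none uv by force
        have stretch: ?case if s: "straight i u v d" for i d
        proof -
          have "\<beta> ^ Suc n * (b - a) \<le> (\<beta> * v - of_int d) - (\<beta> * u - of_int d)"
            using mult_left_mono[OF uv(4), of \<beta>] b0 by (simp add: algebra_simps)
          then show ?thesis using step[OF s uv(3)] straight_image_range[OF s] by blast
        qed
        show ?case
        proof (cases "\<exists>c\<in>T. u < c \<and> c < v")
          case False
          then have "straight True u v (digit u)"
            using uv \<open>u < v\<close> by (intro straight_greedy) (auto simp: T_def)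
          then show ?thesis by (rule stretch)
        next
          case cT: True
          show ?thesis
          proof (cases "\<exists>c\<in>L. u < c \<and> c < v")
            case False
            then have "straight True (M - v) (M - u) (digit (M - v))"
              using uv \<open>u < v\<close> by (intro straight_greedy) (force simp: L_def T_def)+
            from straight_reflect[OF this] have "straight False u v (k - digit (M - v))" by simp
            then show ?thesis by (rule stretch)
          next
            case True
            then obtain c c' where c: "c \<in> T" "u < c" "c < v" "c' \<in> L" "u < c'" "c' < v" using cT by blast
            then have "c = c'" using short by (intro sep) auto
            obtain j where j: "j \<in> {1..k}" "c = of_int j / \<beta>" using c by (auto simp: T_def)
            obtain j' where j': "j' \<in> {1..k}" "M - c = of_int j' / \<beta>" using c \<open>c = c'\<close> by (auto simp: L_def T_def)
            have bc: "\<beta> * c = of_int j" "\<beta> * (M - c) = of_int j'" using j(2) j'(2) b0 by (simp_all add: field_simps)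
            have "\<exists>u v. 0 \<le> u \<and> v \<le> M \<and> \<eta> \<le> v - u \<and> P u v"
              using split[OF uv(1,2) c(2,3) uv(3)]
            proof
              \<comment> \<open>Right piece: the greedy map restarts from 0 at \<open>c\<close>,
                giving an interval in the left corner.\<close>
              assume "P c v"
              have s: "straight True c v j"
                using c uv short \<eta> by (intro straight_greedy_at_discontinuity j) auto
              from step[OF s \<open>P c v\<close>] have "P 0 (\<beta> * v - of_int j)" by (simp add: bc)
              moreover have "\<beta> * c < \<beta> * v" using c b0 by simp
              then have "0 < \<beta> * v - of_int j" using bc by simp
              ultimately have "\<exists>e'. M / \<beta> \<le> e' \<and> e' \<le> M \<and> P 0 e'"
                using step straight_image_range(2)[OF s]
                by (intro expand_left_corner[where P = P and e = "\<beta> * v - of_int j"]) blast+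
              then obtain e' where "M / \<beta> \<le> e'" "e' \<le> M" "P 0 e'" by blast
              then show ?thesis using \<eta>M by (intro exI[of _ 0] exI[of _ e']) auto
            next
              \<comment> \<open>Left piece: the reflected argument, with \<open>j'\<close> the index
                of the greedy discontinuity \<open>M - c\<close>. The lazy branch to the left of
                \<open>c\<close> ends at \<open>M\<close>.\<close>
              assume "P u c"
              have "straight True (M - c) (M - u) j'"
                using c uv short \<eta> j' by (intro straight_greedy_at_discontinuity) auto
              from straight_reflect[OF this] have s: "straight False u c (k - j')" by simp
              define e where "e = M - (\<beta> * u - of_int (k - j'))"
              have cM: "\<beta> * c - of_int (k - j') = M" using bc M_mult by (simp add: algebra_simps)
              have "\<beta> * u - of_int (k - j') = M - e" by (simp add: e_def)
              with step[OF s \<open>P u c\<close>] cM have "P (M - e) M" by metis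
              moreover have "\<beta> * u < \<beta> * c" using c b0 by simp
              then have "0 < e" using cM by (simp add: e_def)
              moreover have "e \<le> M" using straight_image_range(1)[OF s] by (simp add: e_def)
              ultimately have "\<exists>e'. M / \<beta> \<le> e' \<and> e' \<le> M \<and> P (M - e') M"
                using step by (intro expand_right_corner[where P = P and e = e]) blast+
              then obtain e' where "M / \<beta> \<le> e'" "e' \<le> M" "P (M - e') M" by blast
              then show ?thesis using \<eta>M by (intro exI[of _ "M - e'"] exI[of _ M]) auto
            qed
            with none show ?thesis by blast
          qed
        qed
      qed
      then have "\<beta> ^ n * (b - a) \<le> M" for n by (smt (verit))
      moreover obtain n where "M / (b - a) < \<beta> ^ n" using real_arch_pow[OF beta_gt_1] by blast
      then have "M < \<beta> ^ n * (b - a)" using ab by (simp add: field_simps)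
      ultimately show False by (meson not_le)
    qed
  qed
qed

lemma measure_lambda_interval:
  assumes "0 \<le> a" "a \<le> b" "b \<le> M"
  shows "measure (lambda \<beta>) {a..b} = (b - a) / M"
  using assms by (subst measure_lambda) (auto simp: sets_lambda_iff)

text \<open>The measure \<open>D a b\<close> of the part of \<open>{a<..<b}\<close> missing from
  \<open>B\<close> is multiplied by \<beta> under a straight branch, exactly as the length is, so
  their ratio is kept. One nondegenerate interval with \<open>D a b = 0\<close> suffices: complete
  filling passes to subintervals, and \<open>expand_to_all\<close> applies.\<close>

lemma zero_one_of_branch_invariant:
  assumes B: "B \<in> sets (lambda \<beta>)" and inv: "\<And>i. AE x in lambda \<beta>. branch i x \<in> B \<longleftrightarrow> x \<in> B"
  shows "(AE x in lambda \<beta>. x \<in> B) \<or> (AE x in lambda \<beta>. x \<notin> B)"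
proof (cases "measure (lambda \<beta>) B = 0")
  case True
  then have "B \<in> null_sets (lambda \<beta>)" using B by (auto simp: null_sets_def lam.emeasure_eq_measure)
  then show ?thesis using AE_not_in by auto
next
  case False
  define D where "D a b = measure (lambda \<beta>) ({a<..<b} - B)" for a b
  have b0: "\<beta> > 0" using beta_gt_1 by simp
  have Ioo: "{a<..<b} \<in> sets (lambda \<beta>)" if "0 \<le> a" "b \<le> M" for a b
    using that by (auto simp: sets_lambda_iff)
  have D_sets: "{a<..<b} - B \<in> sets (lambda \<beta>)" if "0 \<le> a" "b \<le> M" for a b
    using Ioo[OF that] B by auto
  have D_nn: "0 \<le> D a b" for a b by (simp add: D_def)
  have step: "D (\<beta> * a - of_int d) (\<beta> * b - of_int d) = \<beta> * D a b" if s: "straight i a b d" for i a b d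
  proof -
    have ab: "0 \<le> a" "b \<le> M" using s by (auto simp: straight_def)
    define S where "S = {\<beta> * a - of_int d<..<\<beta> * b - of_int d} - B"
    have S: "S \<in> sets (lambda \<beta>)" unfolding S_def by (rule D_sets) (rule straight_image_range[OF s])+
    have eq: "branch i -` S \<inter> {a<..<b} = (branch i -` S \<inter> {0..M}) \<inter> {a<..<b}" using ab by auto
    have S1: "branch i -` S \<inter> {a<..<b} \<in> sets (lambda \<beta>)"
      unfolding eq using branch_vimage_sets[OF S] Ioo[OF ab] by auto
    have "measure (lambda \<beta>) S = \<beta> * measure (lambda \<beta>) (branch i -` S \<inter> {a<..<b})"
      using straight_image_measure[OF s, of S] S S1 by (simp add: measure_lambda sets_lambda_iff S_def)
    also have "measure (lambda \<beta>) (branch i -` S \<inter> {a<..<b}) = D a b"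
      unfolding D_def
    proof (rule measure_eq_AE[OF _ S1 D_sets[OF ab]])
      show "AE x in lambda \<beta>. x \<in> branch i -` S \<inter> {a<..<b} \<longleftrightarrow> x \<in> {a<..<b} - B"
        using inv[of i]
      proof eventually_elim
        case (elim x)
        have "branch i x = \<beta> * x - of_int d" if "x \<in> {a<..<b}" using s that by (simp add: straight_def)
        then show ?case using elim b0 by (auto simp: S_def)
      qed
    qed
    finally show ?thesis by (simp add: D_def S_def)
  qed
  obtain \<eta> where \<eta>: "\<eta> > 0"
    "\<And>P a b. (\<And>i a b d. straight i a b d \<Longrightarrow> P a b \<Longrightarrow> P (\<beta> * a - of_int d) (\<beta> * b - of_int d)) \<Longrightarrow>
      (\<And>a c b. 0 \<le> a \<Longrightarrow> b \<le> M \<Longrightarrow> a < c \<Longrightarrow> c < b \<Longrightarrow> P a b \<Longrightarrow> P a c \<or> P c b) \<Longrightarrow>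
      0 \<le> a \<Longrightarrow> a < b \<Longrightarrow> b \<le> M \<Longrightarrow> P a b \<Longrightarrow>
      \<exists>u v. 0 \<le> u \<and> v \<le> M \<and> \<eta> \<le> v - u \<and> P u v"
    using expand_to_definite_length by blast
  have good: "\<exists>u v. 0 \<le> u \<and> v \<le> M \<and> \<eta> \<le> v - u \<and> D u v \<le> \<delta> * (v - u)" if "\<delta> > 0" for \<delta>
  proof -
    \<comment> \<open>Dropping the endpoints puts the set inside an open interval without changing
      its measure.\<close>
    define B' where "B' = B \<inter> {0<..<M}"
    have "measure lborel B' = measure lborel B"
    proof (rule measure_eq_AE)
      have "{0, M} \<in> null_sets lborel" by (rule countable_imp_null_set_lborel) auto
      from AE_not_in[OF this] show "AE x in lborel. x \<in> B' \<longleftrightarrow> x \<in> B"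
        by eventually_elim (use B in \<open>auto simp: B'_def sets_lambda_iff\<close>)
    qed (use B in \<open>auto simp: B'_def sets_lambda_iff\<close>)
    then have "0 < measure lborel B'" using False B by (simp add: measure_lambda zero_less_measure_iff)
    moreover have "B' \<in> sets borel" "B' \<subseteq> {0<..<M}" using B by (auto simp: B'_def sets_lambda_iff)
    \<comment> \<open>The factor \<open>M\<close> compensates the normalization of
      \<open>lambda \<beta>\<close>.\<close>
    moreover have "0 < \<delta> * M" using that M_gt_1 by simp
    ultimately obtain a b where ab: "0 \<le> a" "a < b" "b \<le> M" "measure lborel ({a<..<b} - B') \<le> \<delta> * M * (b - a)"
      using ex_interval_almost_full[of B' 0 M "\<delta> * M"] by blast
    have "{a<..<b} - B' = {a<..<b} - B" using ab by (auto simp: B'_def)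
    then have D0: "D a b \<le> \<delta> * (b - a)"
      using ab D_sets[of a b] M_gt_1 by (simp add: D_def measure_lambda field_simps)
    show ?thesis
    proof (rule \<eta>(2)[of "\<lambda>u v. D u v \<le> \<delta> * (v - u)"])
      fix i a b d assume "straight i a b d" "D a b \<le> \<delta> * (b - a)"
      then show "D (\<beta> * a - of_int d) (\<beta> * b - of_int d) \<le> \<delta> * ((\<beta> * b - of_int d) - (\<beta> * a - of_int d))"
        using mult_left_mono[of "D a b" "\<delta> * (b - a)" \<beta>] b0 by (simp add: step algebra_simps)
    next
      fix a c b :: real assume *: "0 \<le> a" "b \<le> M" "a < c" "c < b" "D a b \<le> \<delta> * (b - a)"
      \<comment> \<open>If both pieces exceeded the ratio \<delta>, the whole interval would exceed
        it as well.\<close>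
      have "D a c + D c b = measure (lambda \<beta>) (({a<..<c} - B) \<union> ({c<..<b} - B))"
        unfolding D_def using * D_sets by (intro lam.finite_measure_Union[symmetric]) auto
      also have "\<dots> \<le> D a b"
        unfolding D_def using * D_sets[of a b] by (intro lam.finite_measure_mono) auto
      finally have "D a c + D c b \<le> \<delta> * (c - a) + \<delta> * (b - c)" using * by (simp add: algebra_simps)
      then show "D a c \<le> \<delta> * (c - a) \<or> D c b \<le> \<delta> * (b - c)" by linarith
    qed (use ab D0 in auto)
  qed
  \<comment> \<open>Now \<delta> runs through \<open>1 / real (Suc n)\<close>. The lengths stay at
    least \<eta>, so a limit of the intervals cannot shrink to a point.\<close>
  have "\<exists>q. q \<in> {0..M} \<times> {0..M} \<and> \<eta> \<le> snd q - fst q \<and> D (fst q) (snd q) \<le> 1 / real (Suc n) * M" for n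
  proof -
    obtain u v where uv: "0 \<le> u" "v \<le> M" "\<eta> \<le> v - u" "D u v \<le> 1 / real (Suc n) * (v - u)"
      using good[of "1 / real (Suc n)"] by auto
    have "1 / real (Suc n) * (v - u) \<le> 1 / real (Suc n) * M" using uv by (intro mult_left_mono) auto
    then show ?thesis using uv \<eta>(1) by (intro exI[of _ "(u, v)"]) auto
  qed
  then obtain q where q: "\<And>n. q n \<in> {0..M} \<times> {0..M}" "\<And>n. \<eta> \<le> snd (q n) - fst (q n)"
      "\<And>n. D (fst (q n)) (snd (q n)) \<le> 1 / real (Suc n) * M"
    by metis
  have "compact ({0..M} \<times> {0..M})" by (intro compact_Times compact_Icc)
  then obtain l r where l: "l \<in> {0..M} \<times> {0..M}" "strict_mono (r :: nat \<Rightarrow> nat)" "(q \<circ> r) \<longlonglongrightarrow> l"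
    using q(1) unfolding compact_def by blast
  obtain a b where ab: "l = (a, b)" "0 \<le> a" "b \<le> M" "a \<le> M" "0 \<le> b" using l(1) by (cases l) auto
  define u v where "u n = fst (q (r n))" and "v n = snd (q (r n))" for n
  have lim: "u \<longlonglongrightarrow> a" "v \<longlonglongrightarrow> b"
    using tendsto_fst[OF l(3)] tendsto_snd[OF l(3)] ab by (simp_all add: u_def[abs_def] v_def[abs_def] comp_def)
  have "(\<lambda>n. v n - u n) \<longlonglongrightarrow> b - a" by (intro tendsto_diff lim)
  then have "\<eta> \<le> b - a" by (rule LIMSEQ_le_const) (use q(2) in \<open>auto simp: u_def v_def\<close>)
  then have "a < b" using \<eta>(1) by simp
  have uv: "0 \<le> u n" "u n \<le> M" "0 \<le> v n" "v n \<le> M" for n using q(1)[of "r n"] by (auto simp: u_def v_def)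
  \<comment> \<open>Moving the endpoints from \<open>u n\<close> and \<open>v n\<close> to
    \<open>a\<close> and \<open>b\<close> adds to the missing part at most the two intervals between
    old and new endpoints; dividing by \<open>M > 1\<close> keeps their measure below their
    length.\<close>
  have bound: "D a b \<le> 1 / real (Suc n) * M + \<bar>u n - a\<bar> + \<bar>v n - b\<bar>" for n
  proof -
    let ?A = "{min a (u n)..max a (u n)}" and ?B = "{min b (v n)..max b (v n)}"
    have S: "?A \<in> sets (lambda \<beta>)" "?B \<in> sets (lambda \<beta>)" "{u n<..<v n} - B \<in> sets (lambda \<beta>)"
      using ab uv[of n] D_sets by (auto simp: sets_lambda_iff)
    have len: "measure (lambda \<beta>) {min x y..max x y} \<le> \<bar>y - x\<bar>" if "x \<in> {0..M}" "y \<in> {0..M}" for x y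
    proof -
      have "measure (lambda \<beta>) {min x y..max x y} = (max x y - min x y) / M"
        using that by (intro measure_lambda_interval) auto
      also have "\<dots> = \<bar>y - x\<bar> / M" by (simp add: min_def max_def)
      also have "\<dots> \<le> \<bar>y - x\<bar>" using M_gt_1 mult_left_mono[of 1 M "\<bar>y - x\<bar>"] by (simp add: divide_le_eq)
      finally show ?thesis .
    qed
    have m: "measure (lambda \<beta>) ?A \<le> \<bar>u n - a\<bar>" "measure (lambda \<beta>) ?B \<le> \<bar>v n - b\<bar>"
      using len ab uv[of n] by auto
    have "D a b \<le> measure (lambda \<beta>) (({u n<..<v n} - B) \<union> (?A \<union> ?B))"
      unfolding D_def using S by (intro lam.finite_measure_mono) auto
    also have "\<dots> \<le> D (u n) (v n) + (measure (lambda \<beta>) ?A + measure (lambda \<beta>) ?B)"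
      unfolding D_def using S
      by (intro order_trans[OF measure_Un_le] add_left_mono measure_Un_le) auto
    also have "D (u n) (v n) \<le> 1 / real (Suc (r n)) * M" using q(3)[of "r n"] by (simp add: u_def v_def)
    also have "1 / real (Suc (r n)) * M \<le> 1 / real (Suc n) * M"
      using seq_suble[OF l(2), of n] M_gt_1 by (intro mult_right_mono divide_left_mono) auto
    finally show ?thesis using m by linarith
  qed
  have "(\<lambda>n. 1 / real (Suc n) * M + \<bar>u n - a\<bar> + \<bar>v n - b\<bar>) \<longlonglongrightarrow> 0 * M + \<bar>a - a\<bar> + \<bar>b - b\<bar>"
    by (intro tendsto_intros lim LIMSEQ_Suc[OF lim_1_over_n])
  then have "D a b \<le> 0" using bound by (intro LIMSEQ_le_const[of _ 0]) auto
  then have D_ab: "D a b = 0" using D_nn[of a b] by simp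
  define P where "P a b \<longleftrightarrow> (AE x in lambda \<beta>. x \<in> {a<..<b} \<longrightarrow> x \<in> B)" for a b
  have P_iff: "P a b \<longleftrightarrow> D a b = 0" if "0 \<le> a" "b \<le> M" for a b
  proof -
    have "P a b \<longleftrightarrow> (AE x in lambda \<beta>. x \<notin> {a<..<b} - B)" unfolding P_def by (intro AE_cong) auto
    also have "\<dots> \<longleftrightarrow> {a<..<b} - B \<in> null_sets (lambda \<beta>)" by (rule AE_iff_null_sets[OF D_sets[OF that], symmetric])
    also have "\<dots> \<longleftrightarrow> D a b = 0" using D_sets[OF that] by (auto simp: null_sets_def lam.emeasure_eq_measure D_def)
    finally show ?thesis .
  qed
  have "P 0 M"
  proof (rule expand_to_all)
    fix a b a' b' assume "P a b" and le: "a \<le> a'" "b' \<le> b"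
    then show "P a' b'" unfolding P_def by (auto elim!: eventually_mono)
  next
    fix i a b d assume s: "straight i a b d" and P: "P a b"
    then have "D a b = 0" using P_iff by (auto simp: straight_def)
    then show "P (\<beta> * a - of_int d) (\<beta> * b - of_int d)"
      using step[OF s] straight_image_range[OF s] by (subst P_iff) auto
  next
    show "P a b" using P_iff ab D_ab by auto
  qed (use ab \<open>a < b\<close> in auto)
  moreover have "{0, M} \<in> null_sets (lambda \<beta>)"
    using countable_imp_null_set_lborel[of "{0, M}"] M_gt_1 by (auto simp: null_sets_lambda_iff)
  ultimately have "AE x in lambda \<beta>. x \<in> B"
    unfolding P_def using AE_not_in[of "{0, M}" "lambda \<beta>"] AE_space[of "lambda \<beta>"]
    by (elim AE_mp[rotated 2]) auto
  then show ?thesis ..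
qed

end

section \<open>The skew product\<close>

context random_beta
begin

section \<open>The Bernoulli measure on symbol sequences\<close>

abbreviation "coin \<equiv> measure_pmf (bernoulli_pmf p)"
abbreviation "bern \<equiv> bernoulli_measure p"

sublocale bern: sequence_space coin
  by unfold_locales

lemma bern_eq: "bern = bern.S"
  by (simp add: bernoulli_measure_def)

lemma prob_space_bern: "prob_space bern"
  unfolding bern_eq by unfold_locales

lemma space_bern [simp]: "space bern = UNIV"
  by (simp add: bern_eq space_PiM)

lemma measurable_shift: "shift \<in> measurable bern bern"
  unfolding bern_eq shift_def by (rule measurable_abs_UNIV) (rule measurable_component_singleton, simp)

lemma measurable_case_nat_pair: "(\<lambda>(i, \<omega>). case_nat i \<omega>) \<in> measurable (coin \<Otimes>\<^sub>M bern) bern"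
  unfolding bern_eq by measurable

lemma nn_integral_coin: "(\<integral>\<^sup>+i. f i \<partial>coin) = (\<Sum>i\<in>UNIV. ennreal (weight i) * f i)"
  using p_pos p_less_1 by (simp add: UNIV_bool weight_def mult.commute)

text \<open>A random sequence has the form \<open>case_nat i \<omega>\<close> with \<open>i\<close>
  a coin toss independent of a sequence \<omega> of the same law.\<close>

lemma bern_first_step:
  assumes X: "X \<in> sets bern"
  shows "emeasure bern X = (\<Sum>i\<in>UNIV. ennreal (weight i) * emeasure bern (case_nat i -` X))"
proof -
  interpret b: prob_space bern by (rule prob_space_bern)
  let ?f = "\<lambda>(i, \<omega>). case_nat i \<omega>"
  have "emeasure bern X = emeasure (distr (coin \<Otimes>\<^sub>M bern) bern ?f) X"
    using bern.PiM_iter by (simp add: bern_eq)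
  also have "\<dots> = emeasure (coin \<Otimes>\<^sub>M bern) (?f -` X \<inter> space (coin \<Otimes>\<^sub>M bern))"
    by (rule emeasure_distr[OF measurable_case_nat_pair X])
  also have "\<dots> = (\<integral>\<^sup>+i. emeasure bern (Pair i -` (?f -` X \<inter> space (coin \<Otimes>\<^sub>M bern))) \<partial>coin)"
    using measurable_sets[OF measurable_case_nat_pair X] by (rule b.emeasure_pair_measure_alt)
  also have "\<dots> = (\<integral>\<^sup>+i. emeasure bern (case_nat i -` X) \<partial>coin)"
    by (simp add: space_pair_measure vimage_def)
  finally show ?thesis by (simp add: nn_integral_coin)
qed

lemma measure_bern_first_step:
  assumes X: "X \<in> sets bern"
  shows "measure bern X = (\<Sum>i\<in>UNIV. weight i * measure bern (case_nat i -` X))"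
proof -
  interpret b: prob_space bern by (rule prob_space_bern)
  have "ennreal (measure bern X) = ennreal (\<Sum>i\<in>UNIV. weight i * measure bern (case_nat i -` X))"
    using bern_first_step[OF X] weight_pos
    by (simp add: b.emeasure_eq_measure UNIV_bool ennreal_mult ennreal_plus less_imp_le)
  then show ?thesis using weight_pos by (subst (asm) ennreal_inj) (auto simp: UNIV_bool less_imp_le)
qed

lemma bern_cylinder_sets: "{\<omega>. \<forall>j<n. \<omega> j \<in> E j} \<in> sets bern"
proof -
  have U: "UNIV \<in> sets bern" using sets.top[of bern] by simp
  have "{\<omega>. \<forall>j<n. \<omega> j \<in> E j} = (\<Inter>j\<in>{..<n}. (\<lambda>\<omega>. \<omega> j) -` E j \<inter> space bern) \<inter> UNIV" by auto
  also have "\<dots> \<in> sets bern"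
  proof (cases "n = 0")
    case False
    have "(\<lambda>\<omega>. \<omega> j) -` E j \<inter> space bern \<in> sets bern" for j
      unfolding bern_eq by (rule measurable_sets[OF measurable_component_singleton]) auto
    then show ?thesis using False U by (intro sets.Int sets.finite_INT) auto
  qed (simp add: U)
  finally show ?thesis .
qed

text \<open>Dynkin induction with the generator reshaped: constraints on finitely many coordinates
  are padded with \<open>UNIV\<close> to an initial segment, so that an inner induction on
  \<open>n\<close> can remove the first symbol.\<close>

lemma bern_induct_cylinder [consumes 1, case_names cylinder compl union]:
  assumes S: "S \<in> sets bern"
    and "\<And>n E. Q {\<omega>. \<forall>j<n. \<omega> j \<in> E j}"
    and compl: "\<And>S. S \<in> sets bern \<Longrightarrow> Q S \<Longrightarrow> Q (- S)"
    and union: "\<And>S. disjoint_family S \<Longrightarrow> range S \<subseteq> sets bern \<Longrightarrow> (\<And>i. Q (S i)) \<Longrightarrow> Q (\<Union>i::nat. S i)"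
  shows "Q S"
proof -
  let ?G = "prod_algebra (UNIV::nat set) (\<lambda>_. coin)"
  have eq: "sets bern = sigma_sets UNIV ?G"
    unfolding bern_eq sets_PiM by simp
  have S': "S \<in> sigma_sets UNIV ?G" using S by (simp add: eq)
  have "?G \<subseteq> Pow UNIV" by simp
  from Int_stable_prod_algebra[of UNIV "\<lambda>_. coin"] this S' show ?thesis
  proof (induction rule: sigma_sets_induct_disjoint)
    case (basic A)
    from prod_algebraE[OF this] obtain I E where A: "A = prod_emb UNIV (\<lambda>_. coin) I (Pi\<^sub>E I E)" "finite I" by metis
    obtain n where "I \<subseteq> {..<n}" using finite_nat_iff_bounded A(2) by blast
    then have n: "j < n" if "j \<in> I" for j using that by auto
    have "A = {\<omega>. \<forall>j<n. \<omega> j \<in> (if j \<in> I then E j else UNIV)}"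
      using n by (auto simp: A(1) prod_emb_def PiE_iff)
    then show ?case using assms(2)[of n "\<lambda>j. if j \<in> I then E j else UNIV"] by simp
  next
    case empty
    \<comment> \<open>An unsatisfiable constraint needs a coordinate; \<open>n = 0\<close> would
      give the whole space.\<close>
    have "{\<omega> :: nat \<Rightarrow> bool. \<forall>j<1. \<omega> j \<in> {}} = {}" by auto
    with assms(2)[of 1 "\<lambda>_. {}"] show ?case by metis
  next
    case (compl A)
    then show ?case using assms(3)[of A] by (simp add: eq Compl_eq_Diff_UNIV)
  next
    case (union A)
    then show ?case using assms(4)[of A] by (simp add: eq)
  qed
qed

end

context limit_density
begin

section \<open>Invariance of the product measure\<close>

sublocale bern_mu: pair_prob_space bern \<mu>
proof -
  interpret b: prob_space bern by (rule prob_space_bern)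
  show "pair_prob_space bern \<mu>" by unfold_locales
qed

lemma space_bern_mu: "space (bern \<Otimes>\<^sub>M \<mu>) = UNIV \<times> {0..M}"
  by (simp add: space_pair_measure)

lemma skew_product_eq: "skew_product \<beta> (\<omega>, x) = (shift \<omega>, branch (\<omega> 0) x)"
  by (simp add: skew_product_def branch_def)

lemma measurable_head: "Measurable.pred bern (\<lambda>\<omega>. \<omega> 0)"
proof -
  have "(\<lambda>\<omega>. \<omega> 0) \<in> measurable bern coin"
    unfolding bern_eq by (rule measurable_component_singleton) simp
  then show ?thesis by simp
qed

lemma measurable_skew_product: "skew_product \<beta> \<in> measurable (bern \<Otimes>\<^sub>M \<mu>) (bern \<Otimes>\<^sub>M \<mu>)"
proof -
  note [measurable] = measurable_shift measurable_head measurable_branch_mu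
  have "(\<lambda>z. (shift (fst z), if fst z 0 then branch True (snd z) else branch False (snd z)))
      \<in> measurable (bern \<Otimes>\<^sub>M \<mu>) (bern \<Otimes>\<^sub>M \<mu>)"
    by measurable
  also have "(\<lambda>z. (shift (fst z), if fst z 0 then branch True (snd z) else branch False (snd z))) = skew_product \<beta>"
    by (auto simp: skew_product_def branch_def fun_eq_iff)
  finally show ?thesis .
qed

text \<open>Rectangles suffice. The first symbol is independent of the shifted sequence, so the
  preimage of a rectangle splits into one rectangle per symbol, and the weighted sum of their
  measures is evaluated by stationarity of \<mu>.\<close>

lemma skew_product_preserves: "distr (bern \<Otimes>\<^sub>M \<mu>) (bern \<Otimes>\<^sub>M \<mu>) (skew_product \<beta>) = bern \<Otimes>\<^sub>M \<mu>"
proof (rule pair_measure_eqI[symmetric])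
  fix A B assume A: "A \<in> sets bern" and B: "B \<in> sets \<mu>"
  define H where "H i = {\<omega>. \<omega> 0 = i} \<inter> shift -` A" for i
  have H: "H i \<in> sets bern" for i
    using bern_cylinder_sets[of 1 "\<lambda>_. {i}"] measurable_sets[OF measurable_shift A] by (simp add: H_def)
  have Hm: "emeasure bern (H i) = ennreal (weight i) * emeasure bern A" for i
  proof -
    have "case_nat j -` H i = (if j = i then A else {})" for j
      by (auto simp: H_def shift_def)
    then show ?thesis using bern_first_step[OF H, of i] by (cases i) (auto simp: UNIV_bool)
  qed
  have C: "branch i -` B \<inter> {0..M} \<in> sets \<mu>" for i using branch_vimage_sets B by simp
  have R: "skew_product \<beta> -` (A \<times> B) \<inter> space (bern \<Otimes>\<^sub>M \<mu>) = (\<Union>i\<in>UNIV. H i \<times> (branch i -` B \<inter> {0..M}))"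
  proof (intro equalityI subsetI)
    fix z assume "z \<in> skew_product \<beta> -` (A \<times> B) \<inter> space (bern \<Otimes>\<^sub>M \<mu>)"
    then show "z \<in> (\<Union>i\<in>UNIV. H i \<times> (branch i -` B \<inter> {0..M}))"
      by (cases z) (simp add: space_bern_mu skew_product_eq H_def)
  next
    fix z assume "z \<in> (\<Union>i\<in>UNIV. H i \<times> (branch i -` B \<inter> {0..M}))"
    then show "z \<in> skew_product \<beta> -` (A \<times> B) \<inter> space (bern \<Otimes>\<^sub>M \<mu>)"
      by (cases z) (simp add: space_bern_mu skew_product_eq H_def)
  qed
  have "emeasure (distr (bern \<Otimes>\<^sub>M \<mu>) (bern \<Otimes>\<^sub>M \<mu>) (skew_product \<beta>)) (A \<times> B)
      = emeasure (bern \<Otimes>\<^sub>M \<mu>) (\<Union>i\<in>UNIV. H i \<times> (branch i -` B \<inter> {0..M}))"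
    using A B by (subst emeasure_distr[OF measurable_skew_product]) (auto simp: R)
  also have "\<dots> = (\<Sum>i\<in>UNIV. emeasure (bern \<Otimes>\<^sub>M \<mu>) (H i \<times> (branch i -` B \<inter> {0..M})))"
    using H C by (intro sum_emeasure[symmetric]) (auto simp: disjoint_family_on_def H_def)
  also have "\<dots> = (\<Sum>i\<in>UNIV. ennreal (weight i) * emeasure bern A * emeasure \<mu> (branch i -` B \<inter> {0..M}))"
    using H C by (simp add: mu.emeasure_pair_measure_Times Hm)
  also have "\<dots> = emeasure bern A * emeasure \<mu> B"
    by (simp add: mu_stationary[OF B] sum_distrib_left mult_ac)
  finally show "emeasure bern A * emeasure \<mu> B
      = emeasure (distr (bern \<Otimes>\<^sub>M \<mu>) (bern \<Otimes>\<^sub>M \<mu>) (skew_product \<beta>)) (A \<times> B)" by simp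
qed (simp_all add: bern_mu.M1.sigma_finite_measure mu.sigma_finite_measure)

text \<open>Stationarity passes from sets to functions by viewing \<mu> as the law of a randomly
  chosen branch applied to an independent \<mu>-distributed point.\<close>

lemma nn_integral_mu_stationary:
  assumes f: "f \<in> borel_measurable \<mu>"
  shows "(\<integral>\<^sup>+x. f x \<partial>\<mu>) = (\<Sum>i\<in>UNIV. ennreal (weight i) * (\<integral>\<^sup>+x. f (branch i x) \<partial>\<mu>))"
proof -
  note [measurable] = measurable_branch_mu f
  let ?b = "\<lambda>z. if fst z then branch True (snd z) else branch False (snd z)"
  have b_meas [measurable]: "?b \<in> measurable (coin \<Otimes>\<^sub>M \<mu>) \<mu>" by measurable
  have "distr (coin \<Otimes>\<^sub>M \<mu>) \<mu> ?b = \<mu>"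
  proof (rule measure_eqI)
    fix B assume "B \<in> sets (distr (coin \<Otimes>\<^sub>M \<mu>) \<mu> ?b)"
    then have B: "B \<in> sets \<mu>" by simp
    have "emeasure (distr (coin \<Otimes>\<^sub>M \<mu>) \<mu> ?b) B = emeasure (coin \<Otimes>\<^sub>M \<mu>) (?b -` B \<inter> space (coin \<Otimes>\<^sub>M \<mu>))"
      using B by (simp add: emeasure_distr)
    also have "\<dots> = (\<integral>\<^sup>+i. emeasure \<mu> (Pair i -` (?b -` B \<inter> space (coin \<Otimes>\<^sub>M \<mu>))) \<partial>coin)"
      using measurable_sets[OF b_meas B] by (rule mu.emeasure_pair_measure_alt)
    also have "\<dots> = (\<integral>\<^sup>+i. emeasure \<mu> (branch i -` B \<inter> {0..M}) \<partial>coin)"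
    proof (intro nn_integral_cong arg_cong[where f = "emeasure \<mu>"])
      fix i show "Pair i -` (?b -` B \<inter> space (coin \<Otimes>\<^sub>M \<mu>)) = branch i -` B \<inter> {0..M}"
        by (cases i) (auto simp: space_pair_measure)
    qed
    finally show "emeasure (distr (coin \<Otimes>\<^sub>M \<mu>) \<mu> ?b) B = emeasure \<mu> B"
      by (simp add: nn_integral_coin mu_stationary[OF B])
  qed simp
  then have "(\<integral>\<^sup>+x. f x \<partial>\<mu>) = (\<integral>\<^sup>+x. f x \<partial>distr (coin \<Otimes>\<^sub>M \<mu>) \<mu> ?b)" by simp
  also have "\<dots> = (\<integral>\<^sup>+z. f (?b z) \<partial>(coin \<Otimes>\<^sub>M \<mu>))" by (rule nn_integral_distr) measurable
  also have "\<dots> = (\<integral>\<^sup>+i. \<integral>\<^sup>+x. f (?b (i, x)) \<partial>\<mu> \<partial>coin)"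
    by (rule mu.nn_integral_fst[symmetric]) measurable
  also have "\<dots> = (\<integral>\<^sup>+i. \<integral>\<^sup>+x. f (branch i x) \<partial>\<mu> \<partial>coin)"
  proof (intro nn_integral_cong)
    fix i x show "f (?b (i, x)) = f (branch i x)" by (cases i) auto
  qed
  finally show ?thesis by (simp add: nn_integral_coin)
qed

text \<open>Equality in Jensen's inequality for the square, integrated against the stationary measure.\<close>

lemma harmonic_imp_branch_invariant:
  fixes f :: "real \<Rightarrow> real"
  assumes meas [measurable]: "f \<in> borel_measurable \<mu>"
    and bounds: "\<And>x. x \<in> {0..M} \<Longrightarrow> 0 \<le> f x \<and> f x \<le> 1"
    and harm: "\<And>x. x \<in> {0..M} \<Longrightarrow> f x = (\<Sum>i\<in>UNIV. weight i * f (branch i x))"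
  shows "AE x in \<mu>. f (branch i x) = f x"
proof -
  note [measurable] = measurable_branch_mu
  let ?d = "\<lambda>x. (f (branch True x) - f (branch False x))\<^sup>2"
  have "(\<integral>\<^sup>+x. ennreal ((f x)\<^sup>2) \<partial>\<mu>) + (\<integral>\<^sup>+x. ennreal (p * (1 - p) * ?d x) \<partial>\<mu>)
      = (\<integral>\<^sup>+x. ennreal ((f x)\<^sup>2) + ennreal (p * (1 - p) * ?d x) \<partial>\<mu>)"
    by (rule nn_integral_add[symmetric]) measurable
  also have "\<dots> = (\<integral>\<^sup>+x. ennreal (p * (f (branch True x))\<^sup>2) + ennreal ((1 - p) * (f (branch False x))\<^sup>2) \<partial>\<mu>)"
  proof (rule nn_integral_cong)
    fix x assume "x \<in> space \<mu>"
    then have fx: "f x = p * f (branch True x) + (1 - p) * f (branch False x)"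
      using harm[of x] by (simp add: UNIV_bool weight_def)
    \<comment> \<open>The variance of a two-point law: the mean square exceeds the squared mean by
      \<open>p * (1 - p) * (s - t)\<^sup>2\<close>.\<close>
    have id: "(p * s + (1 - p) * t)\<^sup>2 + p * (1 - p) * (s - t)\<^sup>2 = p * s\<^sup>2 + (1 - p) * t\<^sup>2" for s t :: real
      by (simp add: power2_eq_square algebra_simps)
    have "(f x)\<^sup>2 + p * (1 - p) * ?d x = p * (f (branch True x))\<^sup>2 + (1 - p) * (f (branch False x))\<^sup>2"
      using id[of "f (branch True x)" "f (branch False x)"] by (simp only: fx)
    then show "ennreal ((f x)\<^sup>2) + ennreal (p * (1 - p) * ?d x)
        = ennreal (p * (f (branch True x))\<^sup>2) + ennreal ((1 - p) * (f (branch False x))\<^sup>2)"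
      using p_pos p_less_1 by (simp add: ennreal_plus[symmetric] del: ennreal_plus)
  qed
  also have "\<dots> = (\<integral>\<^sup>+x. ennreal (p * (f (branch True x))\<^sup>2) \<partial>\<mu>) + (\<integral>\<^sup>+x. ennreal ((1 - p) * (f (branch False x))\<^sup>2) \<partial>\<mu>)"
    by (rule nn_integral_add) measurable
  also have "\<dots> = (\<Sum>i\<in>UNIV. ennreal (weight i) * (\<integral>\<^sup>+x. ennreal ((f (branch i x))\<^sup>2) \<partial>\<mu>))"
    using p_pos p_less_1 by (simp add: UNIV_bool weight_def ennreal_mult nn_integral_cmult)
  also have "\<dots> = (\<integral>\<^sup>+x. ennreal ((f x)\<^sup>2) \<partial>\<mu>)"
    by (rule nn_integral_mu_stationary[symmetric]) measurable
  finally have eq: "(\<integral>\<^sup>+x. ennreal ((f x)\<^sup>2) \<partial>\<mu>) + (\<integral>\<^sup>+x. ennreal (p * (1 - p) * ?d x) \<partial>\<mu>)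
      = (\<integral>\<^sup>+x. ennreal ((f x)\<^sup>2) \<partial>\<mu>)" .
  have "(\<integral>\<^sup>+x. ennreal ((f x)\<^sup>2) \<partial>\<mu>) \<le> (\<integral>\<^sup>+x. 1 \<partial>\<mu>)"
    using bounds by (intro nn_integral_mono) (auto simp: power_le_one)
  \<comment> \<open>Finiteness permits cancelling this integral in \<open>eq\<close>.\<close>
  then have "(\<integral>\<^sup>+x. ennreal ((f x)\<^sup>2) \<partial>\<mu>) < top"
    using mu.emeasure_space_1 by (auto simp: less_top[symmetric] top_unique)
  with eq have "(\<integral>\<^sup>+x. ennreal (p * (1 - p) * ?d x) \<partial>\<mu>) = 0"
    using ennreal_add_left_cancel[of "\<integral>\<^sup>+x. ennreal ((f x)\<^sup>2) \<partial>\<mu>" "\<integral>\<^sup>+x. ennreal (p * (1 - p) * ?d x) \<partial>\<mu>" 0]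
    by (auto simp: less_top)
  then have "AE x in \<mu>. ennreal (p * (1 - p) * ?d x) = 0"
    by (subst (asm) nn_integral_0_iff_AE) auto
  then have "AE x in \<mu>. f (branch True x) = f (branch False x)"
    using p_pos p_less_1
    by (elim eventually_mono) (auto simp: ennreal_eq_0_iff mult_le_0_iff)
  then show ?thesis using AE_space[of \<mu>]
  proof eventually_elim
    case (elim x)
    then have "f x = f (branch True x)" using harm[of x] by (simp add: UNIV_bool weight_def algebra_simps)
    with elim show ?case by (cases i) auto
  qed
qed

text \<open>One level suffices, namely the mean \<open>c\<close>: by the zero-one law
  \<open>f\<close> is almost everywhere above \<open>c\<close> or almost everywhere at most
  \<open>c\<close>, and a function on one side of its mean equals it almost everywhere.\<close>

lemma branch_invariant_imp_AE_const:
  fixes f :: "real \<Rightarrow> real"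
  assumes meas [measurable]: "f \<in> borel_measurable \<mu>"
    and bounds: "\<And>x. x \<in> {0..M} \<Longrightarrow> 0 \<le> f x \<and> f x \<le> 1"
    and inv: "\<And>i. AE x in \<mu>. f (branch i x) = f x"
  shows "AE x in \<mu>. f x = (\<integral>x. f x \<partial>\<mu>)"
proof -
  define c where "c = (\<integral>x. f x \<partial>\<mu>)"
  have int: "integrable \<mu> f"
    using bounds by (intro mu.integrable_const_bound[of _ 1]) (auto intro!: AE_I2)
  define B where "B = {x \<in> {0..M}. c < f x}"
  have "{x \<in> space \<mu>. c < f x} \<in> sets \<mu>" by measurable
  then have B: "B \<in> sets (lambda \<beta>)" by (simp add: B_def)
  have "AE x in lambda \<beta>. branch i x \<in> B \<longleftrightarrow> x \<in> B" for i
    using inv[of i] AE_space[of \<mu>] unfolding AE_mu_iff[symmetric]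
    by eventually_elim (use branch_range[of _ i] in \<open>auto simp: B_def\<close>)
  from zero_one_of_branch_invariant[OF B this]
  have "(AE x in \<mu>. 0 \<le> f x - c) \<or> (AE x in \<mu>. 0 \<le> c - f x)"
  proof
    assume "AE x in lambda \<beta>. x \<in> B"
    then have "AE x in \<mu>. 0 \<le> f x - c" unfolding AE_mu_iff[symmetric] by eventually_elim (auto simp: B_def)
    then show ?thesis ..
  next
    assume "AE x in lambda \<beta>. x \<notin> B"
    then have "AE x in \<mu>. 0 \<le> c - f x" unfolding AE_mu_iff[symmetric] using AE_space[of \<mu>]
      by eventually_elim (auto simp: B_def)
    then show ?thesis ..
  qed
  then show ?thesis unfolding c_def[symmetric]
  proof
    assume nn: "AE x in \<mu>. 0 \<le> f x - c"
    have i: "integrable \<mu> (\<lambda>x. f x - c)" using int by simp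
    have "(\<integral>x. f x - c \<partial>\<mu>) = 0" using int mu.prob_space by (simp add: c_def)
    then have "AE x in \<mu>. f x - c = 0" by (simp only: integral_nonneg_eq_0_iff_AE[OF i nn])
    then show "AE x in \<mu>. f x = c" by eventually_elim simp
  next
    assume nn: "AE x in \<mu>. 0 \<le> c - f x"
    have i: "integrable \<mu> (\<lambda>x. c - f x)" using int by simp
    have "(\<integral>x. c - f x \<partial>\<mu>) = 0" using int mu.prob_space by (simp add: c_def)
    then have "AE x in \<mu>. c - f x = 0" by (simp only: integral_nonneg_eq_0_iff_AE[OF i nn])
    then show "AE x in \<mu>. f x = c" by eventually_elim simp
  qed
qed

text \<open>Prescribing the first symbol \<open>i\<close> replaces the section at \<open>x\<close>
  by the section at \<open>branch i x\<close>, which also has measure \<open>c\<close> for almost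
  every \<open>x\<close>. Repeating this peels off a cylinder symbol by symbol; Dynkin induction
  extends the product rule to all \<open>S\<close>.\<close>

lemma section_measure_product:
  assumes A: "A \<in> sets (bern \<Otimes>\<^sub>M \<mu>)"
    and inv: "\<And>\<omega> x. x \<in> {0..M} \<Longrightarrow> (\<omega>, x) \<in> A \<longleftrightarrow> (shift \<omega>, branch (\<omega> 0) x) \<in> A"
    and const: "AE x in \<mu>. measure bern ((\<lambda>\<omega>. (\<omega>, x)) -` A) = c"
    and S: "S \<in> sets bern"
  shows "AE x in \<mu>. measure bern ((\<lambda>\<omega>. (\<omega>, x)) -` A \<inter> S) = c * measure bern S"
proof -
  define s where "s x = (\<lambda>\<omega>. (\<omega>, x)) -` A" for x
  have s [simp]: "s x \<in> sets bern" for x using sets_Pair2[OF A] by (simp add: s_def)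
  have const': "AE x in \<mu>. measure bern (s x) = c" using const by (simp add: s_def)
  have step: "case_nat i -` s x = s (branch i x)" if "x \<in> {0..M}" for i x
    using inv[OF that, of "case_nat i _"] by (simp add: s_def shift_def vimage_def)
  have "AE x in \<mu>. measure bern (s x \<inter> S) = c * measure bern S"
    using S
  proof (induction rule: bern_induct_cylinder)
    case (cylinder n E)
    show ?case
    proof (induction n arbitrary: E)
      case 0
      then show ?case using const' bern_mu.M1.prob_space by simp
    next
      case (Suc n)
      define C where "C = {\<omega>. \<forall>j<n. \<omega> j \<in> E (Suc j)}"
      let ?S = "{\<omega>. \<forall>j<Suc n. \<omega> j \<in> E j}"
      have split: "case_nat i -` ?S = (if i \<in> E 0 then C else {})" for i
        by (auto simp: C_def less_Suc_eq_0_disj)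
      have S: "?S \<in> sets bern" by (rule bern_cylinder_sets)
      have IH: "AE x in \<mu>. measure bern (s x \<inter> C) = c * measure bern C" unfolding C_def by (rule Suc.IH)
      \<comment> \<open>The induction hypothesis is needed at \<open>branch i x\<close>;
        nonsingularity pulls its exceptional null set back.\<close>
      have IH': "AE x in \<mu>. measure bern (s (branch i x) \<inter> C) = c * measure bern C" for i
        using AE_branch[of "\<lambda>x. measure bern (s x \<inter> C) = c * measure bern C" i] IH by (simp add: AE_mu_iff)
      show ?case
        using IH'[of True] IH'[of False] AE_space[of \<mu>]
      proof eventually_elim
        case (elim x)
        have "case_nat i -` (s x \<inter> ?S) = (if i \<in> E 0 then s (branch i x) \<inter> C else {})" for i
          using step[of x i] elim by (simp only: vimage_Int split space_mu) auto
        then have "measure bern (s x \<inter> ?S) = (\<Sum>i\<in>UNIV. weight i * (if i \<in> E 0 then c * measure bern C else 0))"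
          using S elim by (subst measure_bern_first_step) (auto simp: UNIV_bool)
        also have "\<dots> = c * (\<Sum>i\<in>UNIV. weight i * measure bern (case_nat i -` ?S))"
          unfolding split by (auto simp: UNIV_bool algebra_simps)
        also have "\<dots> = c * measure bern ?S" by (simp only: measure_bern_first_step[OF S, symmetric])
        finally show ?case .
      qed
    qed
  next
    case (compl S)
    from compl(2) const' show ?case
    proof eventually_elim
      case (elim x)
      have "s x \<inter> - S = s x - (s x \<inter> S)" by auto
      then have "measure bern (s x \<inter> - S) = measure bern (s x) - measure bern (s x \<inter> S)"
        using bern_mu.M1.finite_measure_Diff[OF s[of x] sets.Int[OF s[of x] compl(1)]] by simp
      also have "\<dots> = c * (1 - measure bern S)" using elim by (simp add: algebra_simps)
      also have "1 - measure bern S = measure bern (- S)"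
        using bern_mu.M1.prob_compl[OF compl(1)] by (simp add: Compl_eq_Diff_UNIV)
      finally show ?case .
    qed
  next
    case (union S)
    from union(3) have "AE x in \<mu>. \<forall>i. measure bern (s x \<inter> S i) = c * measure bern (S i)"
      by (simp add: AE_all_countable)
    then show ?case
    proof eventually_elim
      case (elim x)
      have S: "S i \<in> sets bern" for i using union(2) by blast
      have "(\<lambda>i. measure bern (s x \<inter> S i)) sums measure bern (\<Union>i. s x \<inter> S i)"
      proof (rule bern_mu.M1.finite_measure_UNION)
        show "range (\<lambda>i. s x \<inter> S i) \<subseteq> sets bern" using S s by blast
        show "disjoint_family (\<lambda>i. s x \<inter> S i)" using union(1) unfolding disjoint_family_on_def by blast
      qed
      moreover have "(\<lambda>i. measure bern (s x \<inter> S i)) = (\<lambda>i. c * measure bern (S i))"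
        by (rule ext) (rule elim[rule_format])
      ultimately have 1: "(\<lambda>i. c * measure bern (S i)) sums measure bern (s x \<inter> (\<Union>i. S i))"
        by (simp only: Int_UN_distrib)
      have "(\<lambda>i. c * measure bern (S i)) sums (c * measure bern (\<Union>i. S i))"
        by (rule sums_mult) (rule bern_mu.M1.finite_measure_UNION[OF union(2,1)])
      from sums_unique2[OF 1 this] show ?case .
    qed
  qed
  then show ?thesis by (simp add: s_def)
qed

lemma skew_product_ergodic: "ergodic (bern \<Otimes>\<^sub>M \<mu>) (skew_product \<beta>)"
  unfolding ergodic_def
proof (intro conjI ballI impI measurable_skew_product skew_product_preserves)
  let ?P = "bern \<Otimes>\<^sub>M \<mu>"
  fix A assume A: "A \<in> sets ?P" and pre: "skew_product \<beta> -` A \<inter> space ?P = A"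
  have inv: "(\<omega>, x) \<in> A \<longleftrightarrow> (shift \<omega>, branch (\<omega> 0) x) \<in> A" if "x \<in> {0..M}" for \<omega> x
  proof -
    have "(\<omega>, x) \<in> A \<longleftrightarrow> (\<omega>, x) \<in> skew_product \<beta> -` A \<inter> space ?P" by (simp only: pre)
    also have "\<dots> \<longleftrightarrow> (shift \<omega>, branch (\<omega> 0) x) \<in> A"
      using that by (simp add: space_bern_mu skew_product_eq)
    finally show ?thesis .
  qed
  define f where "f x = measure bern ((\<lambda>\<omega>. (\<omega>, x)) -` A)" for x
  define c where "c = (\<integral>x. f x \<partial>\<mu>)"
  have ef: "emeasure bern ((\<lambda>\<omega>. (\<omega>, x)) -` A) = ennreal (f x)" for x
    by (simp add: f_def bern_mu.M1.emeasure_eq_measure)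
  have f: "f \<in> borel_measurable \<mu>"
    unfolding f_def[abs_def] measure_def
    by (rule borel_measurable_enn2real[OF bern_mu.measurable_emeasure_Pair2[OF A]])
  have f01: "0 \<le> f x \<and> f x \<le> 1" for x by (simp add: f_def)
  \<comment> \<open>Conditioning on the first symbol; exact at every \<open>x\<close>, since
    \<open>A\<close> equals its preimage and not merely up to a null set.\<close>
  have "f x = (\<Sum>i\<in>UNIV. weight i * f (branch i x))" if "x \<in> {0..M}" for x
  proof -
    have "case_nat i -` ((\<lambda>\<omega>. (\<omega>, x)) -` A) = (\<lambda>\<omega>. (\<omega>, branch i x)) -` A" for i
      using inv[OF that, of "case_nat i _"] by (simp add: shift_def vimage_def)
    then show ?thesis unfolding f_def by (subst measure_bern_first_step[OF sets_Pair2[OF A]]) simp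
  qed
  from harmonic_imp_branch_invariant[OF f f01 this] have "AE x in \<mu>. f (branch i x) = f x" for i .
  from branch_invariant_imp_AE_const[OF f f01 this] have "AE x in \<mu>. f x = c"
    unfolding c_def .
  then have const: "AE x in \<mu>. measure bern ((\<lambda>\<omega>. (\<omega>, x)) -` A) = c" by (simp add: f_def)
  have c0: "0 \<le> c" unfolding c_def using f01 by (intro integral_nonneg_AE) auto
  show "emeasure ?P A = 0 \<or> emeasure ?P (space ?P - A) = 0"
  proof (cases "c = 0")
    case True
    have "emeasure ?P A = (\<integral>\<^sup>+x. ennreal (f x) \<partial>\<mu>)"
      by (simp add: bern_mu.emeasure_pair_measure_alt2[OF A] ef)
    also have "\<dots> = (\<integral>\<^sup>+x. 0 \<partial>\<mu>)"
      using \<open>AE x in \<mu>. f x = c\<close> True by (intro nn_integral_cong_AE) auto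
    finally show ?thesis by simp
  next
    case False
    with c0 have c: "0 < c" by simp
    \<comment> \<open>Independence of \<open>A\<close> from itself in the form of measures: the
      product measure restricted to \<open>A\<close> and normalized agrees with the product measure
      on rectangles, by \<open>section_measure_product\<close>. So the two are equal, and the former
      does not charge the complement of \<open>A\<close>.\<close>
    have "?P = density ?P (\<lambda>z. ennreal (1 / c) * indicator A z)"
    proof (rule pair_measure_eqI)
      fix S E assume S: "S \<in> sets bern" and E: "E \<in> sets \<mu>"
      have SE: "S \<times> E \<in> sets ?P" using S E by simp
      have sec: "AE x in \<mu>. measure bern ((\<lambda>\<omega>. (\<omega>, x)) -` A \<inter> S) = c * measure bern S"
        by (rule section_measure_product[OF A _ const S]) (rule inv)
      have "emeasure (density ?P (\<lambda>z. ennreal (1 / c) * indicator A z)) (S \<times> E)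
          = (\<integral>\<^sup>+z. ennreal (1 / c) * indicator (A \<inter> S \<times> E) z \<partial>?P)"
        using A SE by (subst emeasure_density) (auto intro!: nn_integral_cong simp: indicator_def)
      also have "\<dots> = ennreal (1 / c) * emeasure ?P (A \<inter> S \<times> E)"
        using A SE by (subst nn_integral_cmult_indicator) auto
      also have "emeasure ?P (A \<inter> S \<times> E) = (\<integral>\<^sup>+x. emeasure bern ((\<lambda>\<omega>. (\<omega>, x)) -` (A \<inter> S \<times> E)) \<partial>\<mu>)"
        using A SE by (intro bern_mu.emeasure_pair_measure_alt2) auto
      also have "\<dots> = (\<integral>\<^sup>+x. ennreal (c * measure bern S) * indicator E x \<partial>\<mu>)"
      proof (rule nn_integral_cong_AE)
        show "AE x in \<mu>. emeasure bern ((\<lambda>\<omega>. (\<omega>, x)) -` (A \<inter> S \<times> E)) = ennreal (c * measure bern S) * indicator E x"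
          using sec
        proof eventually_elim
          case (elim x)
          have "(\<lambda>\<omega>. (\<omega>, x)) -` (A \<inter> S \<times> E) = (if x \<in> E then (\<lambda>\<omega>. (\<omega>, x)) -` A \<inter> S else {})" by auto
          then show ?case using elim by (simp add: bern_mu.M1.emeasure_eq_measure)
        qed
      qed
      also have "\<dots> = ennreal (c * measure bern S) * emeasure \<mu> E"
        using E by (rule nn_integral_cmult_indicator)
      also have "ennreal (1 / c) * (ennreal (c * measure bern S) * emeasure \<mu> E)
          = ennreal (1 / c) * ennreal c * (ennreal (measure bern S) * emeasure \<mu> E)"
        using c by (simp add: ennreal_mult mult.assoc)
      also have "ennreal (1 / c) * ennreal c = 1"
        using c by (simp add: ennreal_mult[symmetric])
      also have "1 * (ennreal (measure bern S) * emeasure \<mu> E) = emeasure bern S * emeasure \<mu> E"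
        by (simp add: bern_mu.M1.emeasure_eq_measure)
      finally show "emeasure bern S * emeasure \<mu> E
          = emeasure (density ?P (\<lambda>z. ennreal (1 / c) * indicator A z)) (S \<times> E)" by simp
    qed (auto intro: bern_mu.M1.sigma_finite_measure mu.sigma_finite_measure)
    then have "emeasure ?P (space ?P - A) = emeasure (density ?P (\<lambda>z. ennreal (1 / c) * indicator A z)) (space ?P - A)"
      by simp
    also have "\<dots> = (\<integral>\<^sup>+z. ennreal (1 / c) * indicator A z * indicator (space ?P - A) z \<partial>?P)"
      using A by (intro emeasure_density sets.compl_sets borel_measurable_times_ennreal
          borel_measurable_const borel_measurable_indicator)
    also have "\<dots> = (\<integral>\<^sup>+z. 0 \<partial>?P)"
      by (intro nn_integral_cong) (simp split: split_indicator)
    finally show ?thesis by simp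
  qed
qed

text \<open>By Fubini a set is null for either product exactly if almost all its sections at
  \<open>x\<close> are null, and by \<open>AE_mu_iff\<close> almost all means the same for \<mu> and
  \<open>lambda \<beta>\<close>.\<close>

lemma null_sets_bern_mu: "null_sets (bern \<Otimes>\<^sub>M \<mu>) = null_sets (bern \<Otimes>\<^sub>M lambda \<beta>)"
proof -
  interpret bl: pair_prob_space bern "lambda \<beta>" by unfold_locales
  have sets: "sets (bern \<Otimes>\<^sub>M \<mu>) = sets (bern \<Otimes>\<^sub>M lambda \<beta>)" by (intro sets_pair_measure_cong) auto
  have "emeasure (bern \<Otimes>\<^sub>M \<mu>) N = 0 \<longleftrightarrow> emeasure (bern \<Otimes>\<^sub>M lambda \<beta>) N = 0" if N: "N \<in> sets (bern \<Otimes>\<^sub>M \<mu>)" for N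
  proof -
    have N': "N \<in> sets (bern \<Otimes>\<^sub>M lambda \<beta>)" using N sets by simp
    have "emeasure (bern \<Otimes>\<^sub>M \<mu>) N = 0 \<longleftrightarrow> (AE x in \<mu>. emeasure bern ((\<lambda>\<omega>. (\<omega>, x)) -` N) = 0)"
      using bern_mu.measurable_emeasure_Pair2[OF N]
      by (simp add: bern_mu.emeasure_pair_measure_alt2[OF N] nn_integral_0_iff_AE)
    also have "\<dots> \<longleftrightarrow> emeasure (bern \<Otimes>\<^sub>M lambda \<beta>) N = 0"
      using bl.measurable_emeasure_Pair2[OF N']
      by (simp add: AE_mu_iff bl.emeasure_pair_measure_alt2[OF N'] nn_integral_0_iff_AE)
    finally show ?thesis .
  qed
  then show ?thesis using sets by (auto simp: null_sets_def)
qed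

end

theorem theorem4:
  fixes \<beta> p :: real and g :: "real \<Rightarrow> real"
  assumes "\<beta> > 1" and "\<beta> \<notin> \<int>" and "0 < p" and "p < 1"
    and "bv_limit_density \<beta> p g"
  shows "ergodic (bernoulli_measure p \<Otimes>\<^sub>M mu_density \<beta> (one_star \<beta> g)) (skew_product \<beta>)
    \<and> absolutely_continuous (bernoulli_measure p \<Otimes>\<^sub>M mu_density \<beta> (one_star \<beta> g))
                            (bernoulli_measure p \<Otimes>\<^sub>M lambda \<beta>)
    \<and> absolutely_continuous (bernoulli_measure p \<Otimes>\<^sub>M lambda \<beta>)
                            (bernoulli_measure p \<Otimes>\<^sub>M mu_density \<beta> (one_star \<beta> g))
    \<and> (\<exists>d>0. \<forall>x\<in>J \<beta>. d \<le> one_star \<beta> g x)"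
proof -
  interpret limit_density \<beta> p g by unfold_locales fact+
  show ?thesis
    using skew_product_ergodic null_sets_bern_mu h_bounded_below
    by (simp add: absolutely_continuous_def \<mu>_def J_eq)
qed

end
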